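(* Let $\Phi$ be a Hamiltonian action (on the left or on the right) of a Lie group $G$ on a connected symplectic manifold $(M,\omega)$ and let $J:M\to\mathcal G^*$ be a momentum map for that action. There exists a unique action $A$ of the Lie group $G$ on the dual $\mathcal G^*$ of its Lie algebra for which the momentum map $J$ is equivariant, that is, satisfies $$J\bigl(\Phi_g(x)\bigr)=A_g\bigl(J(x)\bigr)\quad\text{for each }x\in M\text{ and }g\in G.$$ The action $A$ is an action on the left (respectively, on the right) if $\Phi$ is an action on the left (respectively, on the right), and its expression is, for $g\in G$, $\xi\in\mathcal G^*$, $$A(g,\xi)=\mathrm{Ad}^*_{g^{-1}}(\xi)+\theta(g)\quad\text{if }\Phi\text{ is an action on the left},$$ $$A(\xi,g)=\mathrm{Ad}^*_{g}(\xi)-\theta(g^{-1})\quad\text{if }\Phi\text{ is an action on the right},$$ with a map $\theta:G\to\mathcal G^*$, called the symplectic cocycle of the Lie group $G$ associated to the momentum map $J$.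
   Context: $\mathcal G=T_eG$ is the Lie algebra of $G$ and $\mathcal G^*$ its dual. $\mathrm{Ad}^*_g:\mathcal G^*\to\mathcal G^*$ is the transpose of $\mathrm{Ad}_g$: $\langle\mathrm{Ad}^*_g\xi,X\rangle=\langle\xi,\mathrm{Ad}_gX\rangle$. Actions are smooth. $\Phi_g:M\to M$ is $x\mapsto\Phi(g,x)$ for an action on the left and $x\mapsto\Phi(x,g)$ for an action on the right; likewise $A_g:\mathcal G^*\to\mathcal G^*$ is $\xi\mapsto A(g,\xi)$ for an action on the left and $\xi\mapsto A(\xi,g)$ for an action on the right. The fundamental vector field $X_M$ associated to $X\in\mathcal G$ is $X_M(x)=\frac{d}{ds}\Phi_{\exp(sX)}(x)\big|_{s=0}$. On a symplectic manifold $(M,\omega)$, a vector field $Z$ is Hamiltonian with Hamiltonian $f\in C^\infty(M,\mathbb R)$ if $\mathrm i(Z)\omega=-df$. The action $\Phi$ is Hamiltonian if $\Phi_g^*\omega=\omega$ for all $g\in G$ and, for every $X\in\mathcal G$, $X_M$ is a Hamiltonian vector field. A momentum map for $\Phi$ is a smooth map $J:M\to\mathcal G^*$ such that, for each $X\in\mathcal G$, the function $x\mapsto\langle J(x),X\rangle$ is a Hamiltonian of $X_M$.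
   Formalization: Uniqueness of A is claimed only among actions having the displayed expression (linear part coadjoint, plus a translation θ); among all actions it fails, e.g. G = R acting trivially on R^2 with J = 0, where both A(g,ξ) = ξ and A(g,ξ) = e^g ξ make J equivariant. *)

theory Defs
  imports "HOL-Analysis.Analysis" "HOL-Algebra.Group"
begin

section \<open>Model spaces\<close>

text \<open>
  The axioms of \<^class>\<open>euclidean_space\<close> without nonemptiness of the basis, so that
  zero-dimensional manifolds and discrete Lie groups are included.
\<close>

class finite_dim_inner = real_inner +
  assumes finite_orthonormal_basis:
    "\<exists>B. finite B \<and> (\<forall>u\<in>B. \<forall>v\<in>B. inner u v = (if u = v then 1 else 0)) \<and>
         (\<forall>x. (\<forall>u\<in>B. inner x u = 0) \<longleftrightarrow> x = 0)"

instance euclidean_space \<subseteq> finite_dim_inner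
  by standard (rule exI[of _ Basis], simp add: inner_Basis euclidean_all_zero_iff)

typedef zero_space = "{0 :: real}" by simp

lemma zero_space_eq: "(x :: zero_space) = y"
  using Rep_zero_space[of x] Rep_zero_space[of y] by (simp add: Rep_zero_space_inject[symmetric])

instantiation zero_space :: finite_dim_inner
begin

definition "0 = Abs_zero_space 0"
definition "x + y = (0 :: zero_space)" for x y :: zero_space
definition "x - y = (0 :: zero_space)" for x y :: zero_space
definition "- x = (0 :: zero_space)" for x :: zero_space
definition "r *\<^sub>R x = (0 :: zero_space)" for x :: zero_space
definition "inner x y = 0" for x y :: zero_space
definition "norm x = 0" for x :: zero_space
definition "sgn x = (0 :: zero_space)" for x :: zero_space
definition "dist x y = 0" for x y :: zero_space
definition "(uniformity :: (zero_space \<times> zero_space) filter) =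
  (INF e\<in>{0 <..}. principal {(x, y). dist x y < e})"
definition "open U \<longleftrightarrow> (\<forall>x\<in>U. eventually (\<lambda>(x', y). x' = x \<longrightarrow> y \<in> U) uniformity)"
  for U :: "zero_space set"

instance
proof
  show "\<exists>B. finite B \<and> (\<forall>u\<in>B. \<forall>v\<in>B. inner u v = (if u = v then 1 else 0)) \<and>
      (\<forall>x :: zero_space. (\<forall>u\<in>B. inner x u = 0) \<longleftrightarrow> x = 0)"
    by (rule exI[of _ "{}"]) (simp add: zero_space_eq)
qed (auto simp: uniformity_zero_space_def open_zero_space_def inner_zero_space_def
      norm_zero_space_def dist_zero_space_def intro: zero_space_eq)

end


section \<open>Smooth maps between open subsets of normed spaces\<close>

primrec Ck_on :: "nat \<Rightarrow> 'a set \<Rightarrow> ('a::real_normed_vector \<Rightarrow> 'b::real_normed_vector) \<Rightarrow> bool" where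
  "Ck_on 0 S f \<longleftrightarrow> continuous_on S f"
| "Ck_on (Suc k) S f \<longleftrightarrow>
     (\<forall>x\<in>S. f differentiable at x) \<and> (\<forall>v. Ck_on k S (\<lambda>x. frechet_derivative f (at x) v))"

text \<open>
  The directional form of \<open>Ck_on\<close> is the usual \<open>C\<^sup>k\<close> property for an open set \<open>S\<close> in a
  finite-dimensional space, the only case used below.
\<close>

definition smooth_on :: "'a set \<Rightarrow> ('a::real_normed_vector \<Rightarrow> 'b::real_normed_vector) \<Rightarrow> bool" where
  "smooth_on S f \<longleftrightarrow> (\<forall>k. Ck_on k S f)"


section \<open>Manifolds\<close>

type_synonym ('m, 'e) chart = "'m set \<times> ('m \<Rightarrow> 'e)"

definition is_chart :: "('m::topological_space, 'e::real_normed_vector) chart \<Rightarrow> bool" where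
  "is_chart = (\<lambda>(U, \<phi>). open U \<and> open (\<phi> ` U) \<and> homeomorphism U (\<phi> ` U) \<phi> (inv_into U \<phi>))"

text \<open>The manifold is the whole type \<open>'m\<close> (in particular nonempty).\<close>

locale smooth_manifold =
  fixes A :: "('m::{t2_space, second_countable_topology}, 'e::finite_dim_inner) chart set"
  assumes charts: "\<And>c. c \<in> A \<Longrightarrow> is_chart c"
    and covers: "(\<Union>(U, \<phi>)\<in>A. U) = UNIV"
    and compatible: "\<And>U \<phi> V \<psi>. (U, \<phi>) \<in> A \<Longrightarrow> (V, \<psi>) \<in> A \<Longrightarrow>
          smooth_on (\<phi> ` (U \<inter> V)) (\<psi> \<circ> inv_into U \<phi>)"

definition smooth_map ::
  "('m::topological_space, 'e::real_normed_vector) chart set \<Rightarrow>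
   ('n::topological_space, 'f::real_normed_vector) chart set \<Rightarrow> ('m \<Rightarrow> 'n) \<Rightarrow> bool" where
  "smooth_map A B f \<longleftrightarrow> continuous_on UNIV f \<and>
     (\<forall>(U, \<phi>)\<in>A. \<forall>(V, \<psi>)\<in>B. smooth_on (\<phi> ` (U \<inter> f -` V)) (\<psi> \<circ> f \<circ> inv_into U \<phi>))"

definition prod_atlas ::
  "('m, 'e) chart set \<Rightarrow> ('n, 'f) chart set \<Rightarrow> ('m \<times> 'n, 'e \<times> 'f) chart set" where
  "prod_atlas A B = (\<lambda>((U, \<phi>), (V, \<psi>)). (U \<times> V, map_prod \<phi> \<psi>)) ` (A \<times> B)"

definition vec_atlas :: "('e::real_normed_vector, 'e) chart set" where
  "vec_atlas = {(UNIV, id)}"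


section \<open>Tangent vectors\<close>

text \<open>
  A tangent vector at \<open>p\<close> is represented by its component vector in one fixed chart around \<open>p\<close>;
  each tangent space is thereby identified with the model space \<open>'e\<close>. For \<^const>\<open>vec_atlas\<close>
  this is the usual identification of the tangent spaces of a vector space with that space.
\<close>

definition chart_at :: "('m, 'e) chart set \<Rightarrow> 'm \<Rightarrow> ('m, 'e) chart" where
  "chart_at A p = (SOME c. c \<in> A \<and> p \<in> fst c)"

definition tangent_map ::
  "('m, 'e::real_normed_vector) chart set \<Rightarrow> ('n, 'f::real_normed_vector) chart set \<Rightarrow>
   ('m \<Rightarrow> 'n) \<Rightarrow> 'm \<Rightarrow> 'e \<Rightarrow> 'f" where
  "tangent_map A B f p =
     (let (U, \<phi>) = chart_at A p; (V, \<psi>) = chart_at B (f p)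
      in frechet_derivative (\<psi> \<circ> f \<circ> inv_into U \<phi>) (at (\<phi> p)))"

definition velocity ::
  "('m, 'e::real_normed_vector) chart set \<Rightarrow> (real \<Rightarrow> 'm) \<Rightarrow> real \<Rightarrow> 'e" where
  "velocity A \<gamma> s = vector_derivative (snd (chart_at A (\<gamma> s)) \<circ> \<gamma>) (at s)"


section \<open>Lie groups\<close>

locale lie_group = group G + smooth_manifold A
  for G :: "'g::{t2_space, second_countable_topology} monoid" (structure)
    and A :: "('g, 'e::finite_dim_inner) chart set" +
  assumes carrier_UNIV: "carrier G = UNIV"
    and smooth_mult: "smooth_map (prod_atlas A A) A (\<lambda>(x, y). x \<otimes> y)"
    and smooth_inv: "smooth_map A A (\<lambda>x. inv x)"

text \<open>
  The Lie algebra is the tangent space at the unit, i.e. \<open>'e\<close>; as it is finite-dimensional,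
  its dual is the type \<open>'e \<Rightarrow>\<^sub>L real\<close> of bounded linear functionals.
\<close>

definition Ad ::
  "'g monoid \<Rightarrow> ('g, 'e::real_normed_vector) chart set \<Rightarrow> 'g \<Rightarrow> 'e \<Rightarrow> 'e" where
  "Ad G A g = tangent_map A A (\<lambda>h. g \<otimes>\<^bsub>G\<^esub> h \<otimes>\<^bsub>G\<^esub> inv\<^bsub>G\<^esub> g) \<one>\<^bsub>G\<^esub>"

definition Ad_star ::
  "'g monoid \<Rightarrow> ('g, 'e::real_normed_vector) chart set \<Rightarrow> 'g \<Rightarrow>
   ('e \<Rightarrow>\<^sub>L real) \<Rightarrow> ('e \<Rightarrow>\<^sub>L real)" where
  "Ad_star G A g \<xi> = Blinfun (\<lambda>X. blinfun_apply \<xi> (Ad G A g X))"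

definition one_parameter_subgroup ::
  "'g::topological_space monoid \<Rightarrow> ('g, 'e::real_normed_vector) chart set \<Rightarrow> 'e \<Rightarrow>
   (real \<Rightarrow> 'g) \<Rightarrow> bool" where
  "one_parameter_subgroup G A X \<gamma> \<longleftrightarrow>
     smooth_map vec_atlas A \<gamma> \<and> (\<forall>s t. \<gamma> (s + t) = \<gamma> s \<otimes>\<^bsub>G\<^esub> \<gamma> t) \<and> velocity A \<gamma> 0 = X"

definition lie_exp ::
  "'g::topological_space monoid \<Rightarrow> ('g, 'e::real_normed_vector) chart set \<Rightarrow> 'e \<Rightarrow> 'g" where
  "lie_exp G A X = (THE \<gamma>. one_parameter_subgroup G A X \<gamma>) 1"


section \<open>Actions\<close>

datatype side = Left | Right

text \<open>
  Actions on either side are given by the family of maps \<open>x \<mapsto> \<Phi> g x\<close>; for an action on the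
  right, \<open>\<Phi> g x\<close> is what is usually written \<open>\<Phi>(x, g)\<close>.
\<close>

definition lie_action ::
  "side \<Rightarrow> 'g::topological_space monoid \<Rightarrow> ('g, 'e::real_normed_vector) chart set \<Rightarrow>
   ('m::topological_space, 'f::real_normed_vector) chart set \<Rightarrow> ('g \<Rightarrow> 'm \<Rightarrow> 'm) \<Rightarrow> bool" where
  "lie_action \<sigma> G A B \<Phi> \<longleftrightarrow>
     (\<forall>x. \<Phi> \<one>\<^bsub>G\<^esub> x = x) \<and>
     (case \<sigma> of
        Left \<Rightarrow> smooth_map (prod_atlas A B) B (\<lambda>(g, x). \<Phi> g x) \<and>
                (\<forall>g h x. \<Phi> (g \<otimes>\<^bsub>G\<^esub> h) x = \<Phi> g (\<Phi> h x))
      | Right \<Rightarrow> smooth_map (prod_atlas B A) B (\<lambda>(x, g). \<Phi> g x) \<and>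
                (\<forall>g h x. \<Phi> (g \<otimes>\<^bsub>G\<^esub> h) x = \<Phi> h (\<Phi> g x)))"

definition fundamental_field ::
  "'g::topological_space monoid \<Rightarrow> ('g, 'e::real_normed_vector) chart set \<Rightarrow>
   ('m, 'f::real_normed_vector) chart set \<Rightarrow> ('g \<Rightarrow> 'm \<Rightarrow> 'm) \<Rightarrow> 'e \<Rightarrow> 'm \<Rightarrow> 'f" where
  "fundamental_field G A B \<Phi> X x = velocity B (\<lambda>s. \<Phi> (lie_exp G A (s *\<^sub>R X)) x) 0"


section \<open>Symplectic manifolds\<close>

definition pullback ::
  "('m, 'e::real_normed_vector) chart set \<Rightarrow> ('n, 'f::real_normed_vector) chart set \<Rightarrow>
   ('m \<Rightarrow> 'n) \<Rightarrow> ('n \<Rightarrow> 'f \<Rightarrow> 'f \<Rightarrow> real) \<Rightarrow> 'm \<Rightarrow> 'e \<Rightarrow> 'e \<Rightarrow> real" where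
  "pullback A B f \<omega> p u v = \<omega> (f p) (tangent_map A B f p u) (tangent_map A B f p v)"

text \<open>The coordinate expression of a 2-form in a chart, on the image of that chart.\<close>

definition local_form ::
  "('m, 'e::real_normed_vector) chart set \<Rightarrow> ('m, 'e) chart \<Rightarrow>
   ('m \<Rightarrow> 'e \<Rightarrow> 'e \<Rightarrow> real) \<Rightarrow> 'e \<Rightarrow> 'e \<Rightarrow> 'e \<Rightarrow> real" where
  "local_form B c \<omega> = pullback vec_atlas B (inv_into (fst c) (snd c)) \<omega>"

text \<open>
  In \<open>closed_form\<close>, the cyclic sum is \<open>d\<omega>(u, v, w)\<close> for constant vector fields \<open>u\<close>, \<open>v\<close>, \<open>w\<close>
  in the coordinates of the chart.
\<close>

locale symplectic_manifold = smooth_manifold B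
  for B :: "('m::{t2_space, second_countable_topology}, 'f::finite_dim_inner) chart set" +
  fixes \<omega> :: "'m \<Rightarrow> 'f \<Rightarrow> 'f \<Rightarrow> real"
  assumes bilinear_form: "\<And>p. bilinear (\<omega> p)"
    and alternating: "\<And>p u. \<omega> p u u = 0"
    and nondegenerate: "\<And>p u. (\<And>v. \<omega> p u v = 0) \<Longrightarrow> u = 0"
    and smooth_form: "\<And>c u v. c \<in> B \<Longrightarrow>
          smooth_on (snd c ` fst c) (\<lambda>y. local_form B c \<omega> y u v)"
    and closed_form: "\<And>c y u v w. c \<in> B \<Longrightarrow> y \<in> snd c ` fst c \<Longrightarrow>
          frechet_derivative (\<lambda>y. local_form B c \<omega> y v w) (at y) u +
          frechet_derivative (\<lambda>y. local_form B c \<omega> y w u) (at y) v +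
          frechet_derivative (\<lambda>y. local_form B c \<omega> y u v) (at y) w = 0"

definition is_hamiltonian_of ::
  "('m::topological_space, 'f::real_normed_vector) chart set \<Rightarrow> ('m \<Rightarrow> 'f \<Rightarrow> 'f \<Rightarrow> real) \<Rightarrow>
   ('m \<Rightarrow> real) \<Rightarrow> ('m \<Rightarrow> 'f) \<Rightarrow> bool" where
  "is_hamiltonian_of B \<omega> f Z \<longleftrightarrow>
     smooth_map B vec_atlas f \<and> (\<forall>p u. \<omega> p (Z p) u = - tangent_map B vec_atlas f p u)"

definition hamiltonian_action ::
  "side \<Rightarrow> 'g::topological_space monoid \<Rightarrow> ('g, 'e::real_normed_vector) chart set \<Rightarrow>
   ('m::topological_space, 'f::real_normed_vector) chart set \<Rightarrow>
   ('m \<Rightarrow> 'f \<Rightarrow> 'f \<Rightarrow> real) \<Rightarrow> ('g \<Rightarrow> 'm \<Rightarrow> 'm) \<Rightarrow> bool" where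
  "hamiltonian_action \<sigma> G A B \<omega> \<Phi> \<longleftrightarrow>
     lie_action \<sigma> G A B \<Phi> \<and>
     (\<forall>g. pullback B B (\<Phi> g) \<omega> = \<omega>) \<and>
     (\<forall>X. \<exists>f. is_hamiltonian_of B \<omega> f (fundamental_field G A B \<Phi> X))"

definition momentum_map ::
  "'g::topological_space monoid \<Rightarrow> ('g, 'e::real_normed_vector) chart set \<Rightarrow>
   ('m::topological_space, 'f::real_normed_vector) chart set \<Rightarrow>
   ('m \<Rightarrow> 'f \<Rightarrow> 'f \<Rightarrow> real) \<Rightarrow> ('g \<Rightarrow> 'm \<Rightarrow> 'm) \<Rightarrow> ('m \<Rightarrow> 'e \<Rightarrow>\<^sub>L real) \<Rightarrow> bool" where
  "momentum_map G A B \<omega> \<Phi> J \<longleftrightarrow>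
     smooth_map B vec_atlas J \<and>
     (\<forall>X. is_hamiltonian_of B \<omega> (\<lambda>x. blinfun_apply (J x) X) (fundamental_field G A B \<Phi> X))"

end

theory Submission
  imports Defs
begin

text \<open>
  Write \<open>c = g\<^sup>-\<^sup>1\<close> for an action on the left and \<open>c = g\<close> for an action on the right. Since
  \<open>exp (s Ad\<^sub>c X) = c exp (s X) c\<^sup>-\<^sup>1\<close>, the map \<open>\<Phi>\<^sub>g\<close> carries the curve \<open>s \<mapsto> \<Phi>\<^bsub>exp (s Ad\<^sub>c X)\<^esub> x\<close> to the
  curve \<open>s \<mapsto> \<Phi>\<^bsub>exp (s X)\<^esub> (\<Phi>\<^sub>g x)\<close>, hence \<open>T\<Phi>\<^sub>g\<close> maps the fundamental field of \<open>Ad\<^sub>c X\<close> to that of \<open>X\<close>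
  (\<open>tangent_map_fundamental_field\<close>). As \<open>\<Phi>\<^sub>g\<close> preserves \<open>\<omega>\<close>, the functions
  \<open>x \<mapsto> \<langle>J (\<Phi>\<^sub>g x), X\<rangle>\<close> and \<open>x \<mapsto> \<langle>J x, Ad\<^sub>c X\<rangle>\<close> have the same differential, and
  \<open>J (\<Phi>\<^sub>g x) - Ad\<^sup>*\<^sub>c (J x)\<close> does not depend on \<open>x\<close> because \<open>M\<close> is connected
  (\<open>momentum_map_defect_constant\<close>). Adding this constant to the linear map \<open>Ad\<^sup>*\<^sub>c\<close> gives an affine map
  \<open>A\<^sub>g\<close> with \<open>J \<circ> \<Phi>\<^sub>g = A\<^sub>g \<circ> J\<close>. The maps \<open>A\<^sub>g\<close> form an action: their linear parts compose correctly, and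
  their translation parts are compared at a point of the image of \<open>J\<close>. The same comparison at one point
  gives uniqueness among the maps with linear part \<open>Ad\<^sup>*\<^sub>c\<close>.

  The exponential map is given by a definite description, so the formula for \<open>exp (s Ad\<^sub>c X)\<close>
  rests on existence and uniqueness of one-parameter subgroups. For uniqueness, if two
  curves \<open>a\<close>, \<open>b\<close> satisfy \<open>a' = TL\<^sub>a X\<close> and \<open>b' = TL\<^sub>b X\<close>, then \<open>a b\<^sup>-\<^sup>1\<close> has zero derivative, so it is constant
  (\<open>left_velocity_imp_quotient_constant\<close>). For existence, the equation \<open>\<gamma>' = TL\<^sub>\<gamma> X\<close> is solved
  near \<open>0\<close> in a chart by Picard iteration; the uniqueness argument shows that the solution is a
  local homomorphism, and it is extended by \<open>\<gamma> t = (\<gamma> (t/n))\<^sup>n\<close>.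

  Smoothness of \<open>A\<close> reduces to that of \<open>g \<mapsto> Ad\<^sub>g X\<close>, a partial derivative of the smooth map
  \<open>(g, h) \<mapsto> g h g\<^sup>-\<^sup>1\<close>.
\<close>

section \<open>Finite-dimensional inner product spaces\<close>

lemma finite_dim_inner_expansion:
  obtains B :: "'a::finite_dim_inner set" where
    "finite B" "\<And>b. b \<in> B \<Longrightarrow> norm b = 1" "\<And>x. x = (\<Sum>b\<in>B. inner x b *\<^sub>R b)"
proof -
  obtain B :: "'a set" where fin: "finite B"
    and on: "\<And>u v. u \<in> B \<Longrightarrow> v \<in> B \<Longrightarrow> inner u v = (if u = v then 1 else 0)"
    and total: "\<And>x. (\<forall>u\<in>B. inner x u = 0) \<longleftrightarrow> x = 0"
    using finite_orthonormal_basis by metis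
  have "x = (\<Sum>b\<in>B. inner x b *\<^sub>R b)" for x
  proof -
    have "inner (x - (\<Sum>b\<in>B. inner x b *\<^sub>R b)) u = 0" if "u \<in> B" for u
    proof -
      have "inner (\<Sum>b\<in>B. inner x b *\<^sub>R b) u = (\<Sum>b\<in>B. if b = u then inner x b else 0)"
        using that by (auto simp: inner_sum_left on intro!: sum.cong)
      then show ?thesis using fin that by (simp add: inner_diff_left)
    qed
    then show ?thesis using total[of "x - (\<Sum>b\<in>B. inner x b *\<^sub>R b)"] by simp
  qed
  moreover have "norm b = 1" if "b \<in> B" for b
    using on[OF that that] by (simp add: norm_eq_1)
  ultimately show thesis using that fin by blast
qed

text \<open>
  Completeness of the model space is what the fixed point theorem needs to solve differential
  equations in charts.
\<close>

instance finite_dim_inner \<subseteq> banach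
proof
  fix X :: "nat \<Rightarrow> 'a::finite_dim_inner" assume X: "Cauchy X"
  obtain B :: "'a set" where B: "\<And>x. x = (\<Sum>b\<in>B. inner x b *\<^sub>R b)"
    using finite_dim_inner_expansion by metis
  have "convergent (\<lambda>n. inner (X n) b)" for b
    using bounded_linear.Cauchy[OF bounded_linear_inner_left X] Cauchy_convergent by blast
  then obtain a where "\<And>b. (\<lambda>n. inner (X n) b) \<longlonglongrightarrow> a b"
    unfolding convergent_def by metis
  then have "(\<lambda>n. \<Sum>b\<in>B. inner (X n) b *\<^sub>R b) \<longlonglongrightarrow> (\<Sum>b\<in>B. a b *\<^sub>R b)"
    by (intro tendsto_intros)
  then show "convergent X" unfolding B[symmetric] convergent_def by blast
qed

text \<open>
  Products of manifolds, such as the domain of a group multiplication, are modelled on products of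
  model spaces.
\<close>

instance prod :: (finite_dim_inner, finite_dim_inner) finite_dim_inner
proof
  obtain B :: "'a set" where B: "finite B"
    "\<And>u v. u \<in> B \<Longrightarrow> v \<in> B \<Longrightarrow> inner u v = (if u = v then 1 else 0)"
    "\<And>x. (\<forall>u\<in>B. inner x u = 0) \<longleftrightarrow> x = 0"
    using finite_orthonormal_basis by metis
  obtain C :: "'b set" where C: "finite C"
    "\<And>u v. u \<in> C \<Longrightarrow> v \<in> C \<Longrightarrow> inner u v = (if u = v then 1 else 0)"
    "\<And>x. (\<forall>u\<in>C. inner x u = 0) \<longleftrightarrow> x = 0"
    using finite_orthonormal_basis by metis
  have 0: "0 \<notin> B" "0 \<notin> C" using B(2)[of 0 0] C(2)[of 0 0] by auto
  have "(\<forall>u \<in> B \<times> {0} \<union> {0} \<times> C. inner x u = 0) \<longleftrightarrow> x = 0" for x :: "'a \<times> 'b"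
    using B(3)[of "fst x"] C(3)[of "snd x"] by (auto simp: ball_Un inner_prod_def prod_eq_iff)
  then show "\<exists>D. finite D \<and> (\<forall>u\<in>D. \<forall>v\<in>D. inner u v = (if u = v then 1 else 0)) \<and>
      (\<forall>x :: 'a \<times> 'b. (\<forall>u\<in>D. inner x u = 0) \<longleftrightarrow> x = 0)"
    using 0 B(1) C(1)
    by (intro exI[of _ "B \<times> {0} \<union> {0} \<times> C"] conjI)
      (auto simp: inner_prod_def B(2) C(2) split: if_split_asm)
qed

section \<open>Calculus of smooth maps\<close>

lemma frechet_derivative_cong:
  assumes "open S" "x \<in> S" "\<And>y. y \<in> S \<Longrightarrow> f y = g y"
  shows "frechet_derivative f (at x) = frechet_derivative g (at x)"
proof -
  have "(f has_derivative D) (at x) \<longleftrightarrow> (g has_derivative D) (at x)" for D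
    using assms has_derivative_transform_within_open[of _ _ x UNIV S]
    by (metis (no_types, lifting))
  then show ?thesis by (simp add: frechet_derivative_def)
qed

lemma differentiable_cong:
  assumes "open S" "x \<in> S" "\<And>y. y \<in> S \<Longrightarrow> f y = g y"
  shows "f differentiable at x \<longleftrightarrow> g differentiable at x"
  using assms has_derivative_transform_within_open[of _ _ x UNIV S]
  unfolding differentiable_def by (metis (no_types, lifting))

lemma Ck_on_subset: "Ck_on k S f \<Longrightarrow> T \<subseteq> S \<Longrightarrow> Ck_on k T f"
proof (induction k arbitrary: f)
  case 0
  then show ?case by (simp add: continuous_on_subset)
next
  case (Suc k)
  have "Ck_on k T (\<lambda>x. frechet_derivative f (at x) v)" for v
    using Suc.IH[OF _ Suc.prems(2), of "\<lambda>x. frechet_derivative f (at x) v"] Suc.prems(1) by simp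
  then show ?case using Suc.prems by auto
qed

lemma Ck_on_cong:
  assumes "open S" "\<And>x. x \<in> S \<Longrightarrow> f x = g x" "Ck_on k S f"
  shows "Ck_on k S g"
  using assms(2,3)
proof (induction k arbitrary: f g)
  case 0
  then show ?case by (simp add: continuous_on_eq)
next
  case (Suc k)
  have "Ck_on k S (\<lambda>x. frechet_derivative g (at x) v)" for v
  proof (rule Suc.IH[of "\<lambda>x. frechet_derivative f (at x) v"])
    show "frechet_derivative f (at x) v = frechet_derivative g (at x) v" if "x \<in> S" for x
      using frechet_derivative_cong[of S x f g] assms(1) Suc.prems that by auto
    show "Ck_on k S (\<lambda>x. frechet_derivative f (at x) v)"
      using Suc.prems(2) unfolding Ck_on.simps by blast
  qed
  moreover have "g differentiable at x" if "x \<in> S" for x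
    using differentiable_cong[of S x f g] assms(1) Suc.prems that by auto
  ultimately show ?case by simp
qed

lemma Ck_on_local:
  assumes "\<And>x. x \<in> S \<Longrightarrow> \<exists>T. open T \<and> x \<in> T \<and> Ck_on k T f"
  shows "Ck_on k S f"
  using assms
proof (induction k arbitrary: f)
  case 0
  have "isCont f x" if "x \<in> S" for x
    using 0[OF that] by (auto simp: continuous_on_eq_continuous_at)
  then show ?case by (simp add: continuous_at_imp_continuous_on)
next
  case (Suc k)
  have "Ck_on k S (\<lambda>x. frechet_derivative f (at x) v)" for v
  proof (rule Suc.IH)
    fix x assume "x \<in> S"
    then show "\<exists>T. open T \<and> x \<in> T \<and> Ck_on k T (\<lambda>x. frechet_derivative f (at x) v)"
      using Suc.prems[of x] unfolding Ck_on.simps by blast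
  qed
  moreover have "f differentiable at x" if "x \<in> S" for x
    using Suc.prems[OF that] by auto
  ultimately show ?case by simp
qed

lemma Ck_on_SucD: "Ck_on (Suc k) S f \<Longrightarrow> Ck_on k S f"
proof (induction k arbitrary: f)
  case 0
  then show ?case
    using continuous_at_imp_continuous_on differentiable_imp_continuous_within
    by (metis Ck_on.simps)
next
  case (Suc k)
  then show ?case by (metis Ck_on.simps(2))
qed

text \<open>
  Any explicit formula \<open>D\<close> for the derivative may be used in place of \<^const>\<open>frechet_derivative\<close>;
  the closure properties below are inductions on the order with \<open>D\<close> given by the usual rules.
\<close>

lemma Ck_on_SucI:
  assumes "open S" "\<And>x. x \<in> S \<Longrightarrow> (f has_derivative D x) (at x)"
    and "\<And>v. Ck_on k S (\<lambda>x. D x v)"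
  shows "Ck_on (Suc k) S f"
proof -
  have "D x = frechet_derivative f (at x)" if "x \<in> S" for x
    using frechet_derivative_at assms(2) that by blast
  then have "Ck_on k S (\<lambda>x. frechet_derivative f (at x) v)" for v
    by (intro Ck_on_cong[OF assms(1) _ assms(3)]) simp
  moreover have "f differentiable at x" if "x \<in> S" for x
    using assms(2)[OF that] unfolding differentiable_def by blast
  ultimately show ?thesis by simp
qed

lemma Ck_on_Suc_has_derivative:
  "Ck_on (Suc k) S f \<Longrightarrow> x \<in> S \<Longrightarrow> (f has_derivative frechet_derivative f (at x)) (at x)"
  unfolding frechet_derivative_works[symmetric] Ck_on.simps by blast

lemma Ck_on_Suc_directional:
  "Ck_on (Suc k) S f \<Longrightarrow> Ck_on k S (\<lambda>x. frechet_derivative f (at x) v)"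
  unfolding Ck_on.simps by blast

lemma Ck_on_const:
  assumes "open S"
  shows "Ck_on k S (\<lambda>_. c)"
proof (induction k arbitrary: c)
  case (Suc k)
  show ?case by (rule Ck_on_SucI[OF assms has_derivative_const Suc.IH])
qed simp

lemma Ck_on_ident:
  assumes "open S"
  shows "Ck_on k S (\<lambda>x. x)"
proof (cases k)
  case (Suc k)
  show ?thesis unfolding Suc
    by (rule Ck_on_SucI[OF assms has_derivative_ident Ck_on_const[OF assms]])
qed simp

lemma Ck_on_bounded_linear_compose:
  assumes "bounded_linear h" "open S" "Ck_on k S f"
  shows "Ck_on k S (\<lambda>x. h (f x))"
  using assms(3)
proof (induction k arbitrary: f)
  case 0
  then show ?case using bounded_linear.continuous_on[OF assms(1)] by simp
next
  case (Suc k)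
  show ?case
    by (rule Ck_on_SucI[OF assms(2) bounded_linear.has_derivative[OF assms(1)
          Ck_on_Suc_has_derivative[OF Suc.prems]] Suc.IH[OF Ck_on_Suc_directional[OF Suc.prems]]])
qed

lemma Ck_on_Pair:
  assumes "open S" "Ck_on k S f" "Ck_on k S g"
  shows "Ck_on k S (\<lambda>x. (f x, g x))"
  using assms(2,3)
proof (induction k arbitrary: f g)
  case 0
  then show ?case by (simp add: continuous_on_Pair)
next
  case (Suc k)
  note f = Suc.prems(1) and g = Suc.prems(2)
  show ?case
    by (rule Ck_on_SucI[OF assms(1) has_derivative_Pair[OF Ck_on_Suc_has_derivative[OF f]
          Ck_on_Suc_has_derivative[OF g]] Suc.IH[OF Ck_on_Suc_directional[OF f]
          Ck_on_Suc_directional[OF g]]])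
qed

lemma Ck_on_add:
  assumes "open S" "Ck_on k S f" "Ck_on k S g"
  shows "Ck_on k S (\<lambda>x. f x + g x)"
  using Ck_on_bounded_linear_compose[OF _ assms(1) Ck_on_Pair[OF assms],
      of "\<lambda>p. fst p + snd p"]
  by (simp add: bounded_linear_add bounded_linear_fst bounded_linear_snd)

lemma Ck_on_sum:
  assumes "open S" "\<And>i. i \<in> I \<Longrightarrow> Ck_on k S (f i)"
  shows "Ck_on k S (\<lambda>x. \<Sum>i\<in>I. f i x)"
  using assms(2)
  by (induction I rule: infinite_finite_induct)
    (auto simp: Ck_on_const[OF assms(1)] Ck_on_add[OF assms(1)])

lemma Ck_on_bilinear:
  assumes "bounded_bilinear mul" "open S" "Ck_on k S f" "Ck_on k S g"
  shows "Ck_on k S (\<lambda>x. mul (f x) (g x))"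
  using assms(3,4)
proof (induction k arbitrary: f g)
  case 0
  then show ?case using bounded_bilinear.continuous_on[OF assms(1)] by simp
next
  case (Suc k)
  note f = Suc.prems(1) and g = Suc.prems(2)
  show ?case
    using bounded_bilinear.FDERIV[OF assms(1) Ck_on_Suc_has_derivative[OF f]
        Ck_on_Suc_has_derivative[OF g]]
      Ck_on_add[OF assms(2) Suc.IH[OF Ck_on_SucD[OF f] Ck_on_Suc_directional[OF g]]
        Suc.IH[OF Ck_on_Suc_directional[OF f] Ck_on_SucD[OF g]]]
    by (rule Ck_on_SucI[OF assms(2)])
qed

text \<open>
  In a finite-dimensional intermediate space the chain rule can be written with finitely many
  directional derivatives, \<open>D(g \<circ> f)(x) v = (\<Sum>b. \<langle>Df(x) v, b\<rangle> (D\<^sub>b g)(f x))\<close>; this reduces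
  \<open>C\<^sup>k\<^sup>+\<^sup>1\<close> to products of \<open>C\<^sup>k\<close> compositions.
\<close>

lemma Ck_on_compose:
  fixes f :: "'a::real_normed_vector \<Rightarrow> 'b::finite_dim_inner"
    and g :: "'b \<Rightarrow> 'c::real_normed_vector"
  assumes "open S" "f ` S \<subseteq> T" "Ck_on k S f" "Ck_on k T g"
  shows "Ck_on k S (\<lambda>x. g (f x))"
  using assms(3,4)
proof (induction k arbitrary: g)
  case 0
  then show ?case using assms(2) by (auto intro: continuous_on_compose2)
next
  case (Suc k)
  note f = Suc.prems(1) and g = Suc.prems(2)
  obtain B :: "'b set" where B: "\<And>x. x = (\<Sum>b\<in>B. inner x b *\<^sub>R b)"
    using finite_dim_inner_expansion by metis
  show ?case
  proof (rule Ck_on_SucI[OF assms(1)])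
    fix x assume x: "x \<in> S"
    let ?F = "frechet_derivative f (at x)" and ?D = "frechet_derivative g (at (f x))"
    have fx: "f x \<in> T" using x assms(2) by blast
    have D: "((\<lambda>x. g (f x)) has_derivative (\<lambda>v. ?D (?F v))) (at x)"
      using has_derivative_compose[OF Ck_on_Suc_has_derivative[OF f x]
          Ck_on_Suc_has_derivative[OF g fx]] .
    have lin: "linear ?D"
      using Ck_on_Suc_has_derivative[OF g fx] has_derivative_linear by blast
    have E: "?D w = (\<Sum>b\<in>B. inner w b *\<^sub>R ?D b)" for w
      using arg_cong[OF B[of w], of ?D] by (simp add: linear_sum[OF lin] linear_scale[OF lin])
    show "((\<lambda>x. g (f x)) has_derivative (\<lambda>v. \<Sum>b\<in>B. inner (?F v) b *\<^sub>R ?D b)) (at x)"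
      using D unfolding E[of "?F _"] .
  next
    fix v
    show "Ck_on k S (\<lambda>x. \<Sum>b\<in>B. inner (frechet_derivative f (at x) v) b *\<^sub>R
        frechet_derivative g (at (f x)) b)"
      by (rule Ck_on_sum[OF assms(1)], rule Ck_on_bilinear[OF bounded_bilinear_scaleR assms(1)],
          rule Ck_on_bounded_linear_compose[OF bounded_linear_inner_left assms(1)
            Ck_on_Suc_directional[OF f]],
          rule Suc.IH[OF Ck_on_SucD[OF f] Ck_on_Suc_directional[OF g]])
  qed
qed

lemma smooth_on_subset: "smooth_on S f \<Longrightarrow> T \<subseteq> S \<Longrightarrow> smooth_on T f"
  using Ck_on_subset unfolding smooth_on_def by blast

lemma smooth_on_cong:
  "open S \<Longrightarrow> (\<And>x. x \<in> S \<Longrightarrow> f x = g x) \<Longrightarrow> smooth_on S f \<Longrightarrow> smooth_on S g"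
  using Ck_on_cong unfolding smooth_on_def by blast

lemma smooth_on_local:
  "(\<And>x. x \<in> S \<Longrightarrow> \<exists>T. open T \<and> x \<in> T \<and> smooth_on T f) \<Longrightarrow> smooth_on S f"
  using Ck_on_local unfolding smooth_on_def by metis

lemma smooth_on_const: "open S \<Longrightarrow> smooth_on S (\<lambda>_. c)"
  by (simp add: smooth_on_def Ck_on_const)

lemma smooth_on_ident: "open S \<Longrightarrow> smooth_on S (\<lambda>x. x)"
  by (simp add: smooth_on_def Ck_on_ident)

lemma smooth_on_bounded_linear: "bounded_linear h \<Longrightarrow> open S \<Longrightarrow> smooth_on S h"
  using Ck_on_bounded_linear_compose[of h S _ "\<lambda>x. x"] by (simp add: smooth_on_def Ck_on_ident)

lemma smooth_on_Pair:
  "open S \<Longrightarrow> smooth_on S f \<Longrightarrow> smooth_on S g \<Longrightarrow> smooth_on S (\<lambda>x. (f x, g x))"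
  by (simp add: smooth_on_def Ck_on_Pair)

lemma smooth_on_add:
  "open S \<Longrightarrow> smooth_on S f \<Longrightarrow> smooth_on S g \<Longrightarrow> smooth_on S (\<lambda>x. f x + g x)"
  by (simp add: smooth_on_def Ck_on_add)

lemma smooth_on_bilinear:
  "bounded_bilinear mul \<Longrightarrow> open S \<Longrightarrow> smooth_on S f \<Longrightarrow> smooth_on S g \<Longrightarrow>
    smooth_on S (\<lambda>x. mul (f x) (g x))"
  by (simp add: smooth_on_def Ck_on_bilinear)

lemma smooth_on_compose:
  fixes f :: "'a::real_normed_vector \<Rightarrow> 'b::finite_dim_inner"
  assumes "open S" "f ` S \<subseteq> T" "smooth_on S f" "smooth_on T g"
  shows "smooth_on S (\<lambda>x. g (f x))"
  using assms Ck_on_compose unfolding smooth_on_def by blast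

lemma smooth_on_derivative: "smooth_on S f \<Longrightarrow> smooth_on S (\<lambda>x. frechet_derivative f (at x) v)"
  unfolding smooth_on_def by (blast intro: Ck_on_Suc_directional)

lemma smooth_on_imp_has_derivative:
  "smooth_on S f \<Longrightarrow> x \<in> S \<Longrightarrow> (f has_derivative frechet_derivative f (at x)) (at x)"
  unfolding smooth_on_def by (blast intro: Ck_on_Suc_has_derivative)

lemma smooth_on_imp_continuous_on: "smooth_on S f \<Longrightarrow> continuous_on S f"
  unfolding smooth_on_def by (metis Ck_on.simps(1))

section \<open>Local solutions of smooth ordinary differential equations\<close>

lemma norm_le_of_derivative_bound:
  fixes u :: "real \<Rightarrow> 'a::real_normed_vector"
  assumes "convex I" "0 \<in> I" "t \<in> I" "u 0 = 0"
    and "\<And>s. s \<in> I \<Longrightarrow> (u has_vector_derivative u' s) (at s within I)"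
    and "\<And>s. s \<in> I \<Longrightarrow> norm (u' s) \<le> C"
  shows "norm (u t) \<le> C * \<bar>t\<bar>"
proof -
  have "norm (u t - u 0) \<le> C * norm (t - 0)"
  proof (rule differentiable_bound[OF assms(1) _ _ assms(3,2)])
    show "(u has_derivative (\<lambda>h. h *\<^sub>R u' s)) (at s within I)" if "s \<in> I" for s
      using assms(5)[OF that] by (simp add: has_vector_derivative_def)
    show "onorm (\<lambda>h. h *\<^sub>R u' s) \<le> C" if "s \<in> I" for s
      using mult_left_mono[OF assms(6)[OF that] abs_ge_zero] by (intro onorm_le) (simp add: mult.commute)
  qed
  then show ?thesis using assms(4) by simp
qed

text \<open>
  Picard iteration: on a short interval \<open>{-\<epsilon>..\<epsilon>}\<close> the map
  \<open>y \<mapsto> (\<lambda>t. y\<^sub>0 + \<integral>\<^sub>0\<^sup>t V (y s) ds)\<close> is a contraction of the curves with values in the ball.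
  Curves are extended to the real line by constants so that they form a complete space of
  bounded continuous functions.
\<close>

lemma picard_local_solution:
  fixes V :: "'a::banach \<Rightarrow> 'a"
  assumes r: "0 < r" and lip: "L-lipschitz_on (cball y\<^sub>0 r) V"
  obtains \<epsilon> y where "0 < \<epsilon>" "y 0 = y\<^sub>0"
    "\<And>t. t \<in> {-\<epsilon><..<\<epsilon>} \<Longrightarrow> y t \<in> cball y\<^sub>0 r"
    "\<And>t. t \<in> {-\<epsilon><..<\<epsilon>} \<Longrightarrow> (y has_vector_derivative V (y t)) (at t)"
proof -
  have L: "0 \<le> L" using lip by (rule lipschitz_on_nonneg)
  define M where "M = norm (V y\<^sub>0) + L * r"
  have M0: "0 \<le> M" using L r by (simp add: M_def)
  have M: "norm (V x) \<le> M" if "x \<in> cball y\<^sub>0 r" for x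
  proof -
    have "dist (V x) (V y\<^sub>0) \<le> L * dist x y\<^sub>0"
      using lip that r by (auto intro!: lipschitz_onD)
    also have "\<dots> \<le> L * r" using that L by (auto intro!: mult_left_mono simp: dist_commute)
    finally have "norm (V x - V y\<^sub>0) \<le> L * r" by (simp add: dist_norm)
    then show ?thesis using norm_triangle_ineq2[of "V x" "V y\<^sub>0"] by (simp add: M_def)
  qed
  define \<epsilon> where "\<epsilon> = min (r / (M + 1)) (1 / (2 * (L + 1)))"
  have \<epsilon>: "0 < \<epsilon>" using r L M0 by (simp add: \<epsilon>_def)
  have "\<epsilon> * (M + 1) \<le> r" "\<epsilon> * (2 * (L + 1)) \<le> 1"
    using M0 L by (simp_all add: \<epsilon>_def pos_le_divide_eq[symmetric])
  then have \<epsilon>M: "M * \<epsilon> \<le> r" and \<epsilon>L: "L * \<epsilon> \<le> 1/2"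
    using \<epsilon> by (simp_all add: algebra_simps)
  let ?I = "{-\<epsilon>..\<epsilon>}"
  define c where "c = (\<lambda>t. max (-\<epsilon>) (min \<epsilon> t))"
  have c: "c t \<in> ?I" for t using \<epsilon> by (auto simp: c_def)
  have c_cont: "continuous_on UNIV c" unfolding c_def by (intro continuous_intros)
  define S :: "(real \<Rightarrow>\<^sub>C 'a) set" where "S = PiC UNIV (\<lambda>_. cball y\<^sub>0 r)"
  have S: "f \<in> S \<longleftrightarrow> (\<forall>t. apply_bcontfun f t \<in> cball y\<^sub>0 r)" for f
    by (simp add: S_def mem_PiC_iff Pi_iff)
  define J where "J = (\<lambda>(f :: real \<Rightarrow>\<^sub>C 'a) t. integral {-\<epsilon>..t} (\<lambda>s. V (apply_bcontfun f s))
     - integral {-\<epsilon>..0} (\<lambda>s. V (apply_bcontfun f s)))"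
  have J0: "J f 0 = 0" for f by (simp add: J_def)
  have J_deriv: "(J f has_vector_derivative V (apply_bcontfun f t)) (at t within ?I)"
    if "f \<in> S" "t \<in> ?I" for f t
  proof -
    have "continuous_on ?I (\<lambda>s. V (apply_bcontfun f s))"
      using that S by (intro continuous_on_compose2[OF lipschitz_on_continuous_on[OF lip]]) auto
    from integral_has_vector_derivative[OF this that(2)] show ?thesis
      unfolding J_def by (auto intro!: derivative_eq_intros)
  qed
  have J_bound: "norm (J f t) \<le> r" if "f \<in> S" "t \<in> ?I" for f t
  proof -
    have "norm (J f t) \<le> M * \<bar>t\<bar>"
      using that S \<epsilon> J0 J_deriv M
      by (intro norm_le_of_derivative_bound[of ?I t "J f" "\<lambda>s. V (apply_bcontfun f s)"]) auto
    also have "\<dots> \<le> M * \<epsilon>" using that M0 by (intro mult_left_mono) auto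
    finally show ?thesis using \<epsilon>M by linarith
  qed
  have J_contr: "norm (J f t - J g t) \<le> 1/2 * dist f g" if "f \<in> S" "g \<in> S" "t \<in> ?I" for f g t
  proof -
    have "norm (J f t - J g t) \<le> (L * dist f g) * \<bar>t\<bar>"
    proof (rule norm_le_of_derivative_bound[of ?I t "\<lambda>t. J f t - J g t"
          "\<lambda>s. V (apply_bcontfun f s) - V (apply_bcontfun g s)"])
      fix s assume s: "s \<in> ?I"
      show "((\<lambda>t. J f t - J g t) has_vector_derivative
          V (apply_bcontfun f s) - V (apply_bcontfun g s)) (at s within ?I)"
        using J_deriv that s by (intro has_vector_derivative_diff) auto
      have "norm (V (apply_bcontfun f s) - V (apply_bcontfun g s))
          \<le> L * dist (apply_bcontfun f s) (apply_bcontfun g s)"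
        using lip that S by (auto simp: dist_norm[symmetric] intro!: lipschitz_onD)
      also have "\<dots> \<le> L * dist f g" by (intro mult_left_mono dist_bounded L)
      finally show "norm (V (apply_bcontfun f s) - V (apply_bcontfun g s)) \<le> L * dist f g" .
    qed (use that \<epsilon> J0 in auto)
    also have "\<dots> \<le> (L * dist f g) * \<epsilon>" using that L by (intro mult_left_mono) auto
    also have "\<dots> = (L * \<epsilon>) * dist f g" by simp
    also have "\<dots> \<le> 1/2 * dist f g" by (intro mult_right_mono \<epsilon>L) simp
    finally show ?thesis .
  qed
  define T where "T = (\<lambda>f. Bcontfun (\<lambda>t. y\<^sub>0 + J f (c t)))"
  have T: "apply_bcontfun (T f) t = y\<^sub>0 + J f (c t)" if "f \<in> S" for f t
  proof -
    have "continuous_on ?I (J f)"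
      using J_deriv[OF that] continuous_on_eq_continuous_within has_vector_derivative_continuous
      by blast
    then have "continuous_on UNIV (\<lambda>t. y\<^sub>0 + J f (c t))"
      using c by (intro continuous_intros continuous_on_compose2[OF _ c_cont]) auto
    moreover have "norm (y\<^sub>0 + J f (c t)) \<le> norm y\<^sub>0 + r" for t
      using norm_triangle_ineq[of y\<^sub>0 "J f (c t)"] J_bound[OF that c[of t]] by linarith
    ultimately have "(\<lambda>t. y\<^sub>0 + J f (c t)) \<in> bcontfun" by (rule bcontfun_normI)
    then show ?thesis by (simp add: T_def Bcontfun_inverse)
  qed
  have "\<exists>!f\<in>S. T f = f"
  proof (rule Banach_fix[of S "1/2"])
    show "complete S"
      unfolding S_def complete_eq_closed by (intro closed_PiC) simp
    have "const_bcontfun y\<^sub>0 \<in> S" using r by (simp add: S const_bcontfun.rep_eq)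
    then show "S \<noteq> {}" by blast
    show "T ` S \<subseteq> S"
      using J_bound c by (auto simp: S[of "T _"] T dist_norm)
    show "dist (T f) (T g) \<le> 1/2 * dist f g" if "f \<in> S" "g \<in> S" for f g
      using J_contr[OF that c] that by (intro dist_bound) (simp add: T dist_norm)
  qed auto
  then obtain f where f: "f \<in> S" "T f = f" by blast
  have fix_eq: "apply_bcontfun f t = y\<^sub>0 + J f (c t)" for t using T[OF f(1), of t] f(2) by simp
  show thesis
  proof (rule that[OF \<epsilon>])
    have "c 0 = 0" using \<epsilon> by (simp add: c_def)
    then show "apply_bcontfun f 0 = y\<^sub>0" by (simp add: fix_eq J0)
    fix t assume t: "t \<in> {-\<epsilon><..<\<epsilon>}"
    show "apply_bcontfun f t \<in> cball y\<^sub>0 r" using f S by blast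
    have "(J f has_vector_derivative V (apply_bcontfun f t)) (at t)"
      using J_deriv[OF f(1), of t] t by (simp add: at_within_Icc_at)
    then have "((\<lambda>t. y\<^sub>0 + J f t) has_vector_derivative V (apply_bcontfun f t)) (at t)"
      by (auto intro!: derivative_eq_intros)
    then show "(apply_bcontfun f has_vector_derivative V (apply_bcontfun f t)) (at t)"
      by (rule has_vector_derivative_transform_within_open[where S = "{-\<epsilon><..<\<epsilon>}"])
        (use t in \<open>auto simp: fix_eq c_def min_def max_def\<close>)
  qed
qed

text \<open>
  The directional derivatives along an orthonormal family are continuous, so on a small ball they
  are bounded and with them the operator norm of the derivative.
\<close>

lemma smooth_on_imp_locally_lipschitz:
  fixes V :: "'a::finite_dim_inner \<Rightarrow> 'b::real_normed_vector"
  assumes "open S" "y\<^sub>0 \<in> S" "smooth_on S V"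
  obtains r L where "0 < r" "cball y\<^sub>0 r \<subseteq> S" "L-lipschitz_on (cball y\<^sub>0 r) V"
proof -
  obtain B :: "'a set" where fin: "finite B" and unit: "\<And>b. b \<in> B \<Longrightarrow> norm b = 1"
    and B: "\<And>x. x = (\<Sum>b\<in>B. inner x b *\<^sub>R b)"
    using finite_dim_inner_expansion by metis
  define D where "D = (\<lambda>y. frechet_derivative V (at y))"
  have D: "(V has_derivative D y) (at y)" if "y \<in> S" for y
    unfolding D_def using smooth_on_imp_has_derivative[OF assms(3) that] .
  have "isCont (\<lambda>y. \<Sum>b\<in>B. norm (D y b)) y\<^sub>0"
    using smooth_on_imp_continuous_on[OF smooth_on_derivative[OF assms(3)]] assms(1,2)
    by (intro continuous_intros) (auto simp: continuous_on_eq_continuous_at D_def)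
  then have "((\<lambda>y. \<Sum>b\<in>B. norm (D y b)) \<longlongrightarrow> (\<Sum>b\<in>B. norm (D y\<^sub>0 b))) (nhds y\<^sub>0)"
    using tendsto_at_iff_tendsto_nhds[of "\<lambda>y. \<Sum>b\<in>B. norm (D y b)" y\<^sub>0]
    unfolding isCont_def by blast
  then have "\<forall>\<^sub>F y in nhds y\<^sub>0. (\<Sum>b\<in>B. norm (D y b)) < (\<Sum>b\<in>B. norm (D y\<^sub>0 b)) + 1"
    by (rule order_tendstoD) simp
  moreover have "\<forall>\<^sub>F y in nhds y\<^sub>0. y \<in> S"
    using assms(1,2) by (rule eventually_nhds_in_open)
  ultimately have "\<forall>\<^sub>F y in nhds y\<^sub>0. y \<in> S \<and> (\<Sum>b\<in>B. norm (D y b)) < (\<Sum>b\<in>B. norm (D y\<^sub>0 b)) + 1"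
    by eventually_elim auto
  then obtain d where d: "0 < d" "\<And>y. dist y y\<^sub>0 < d \<Longrightarrow> y \<in> S"
    "\<And>y. dist y y\<^sub>0 < d \<Longrightarrow> (\<Sum>b\<in>B. norm (D y b)) < (\<Sum>b\<in>B. norm (D y\<^sub>0 b)) + 1"
    unfolding eventually_nhds_metric by blast
  let ?K = "(\<Sum>b\<in>B. norm (D y\<^sub>0 b)) + 1"
  have "norm (V x - V y) \<le> ?K * norm (x - y)" if "x \<in> cball y\<^sub>0 (d/2)" "y \<in> cball y\<^sub>0 (d/2)" for x y
  proof (rule differentiable_bound[OF convex_cball _ _ that])
    fix z assume "z \<in> cball y\<^sub>0 (d/2)"
    then have z: "dist z y\<^sub>0 < d" using d(1) by (simp add: dist_commute)
    show "(V has_derivative D z) (at z within cball y\<^sub>0 (d/2))"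
      using D[OF d(2)[OF z]] by (rule has_derivative_at_withinI)
    have lin: "linear (D z)" using D[OF d(2)[OF z]] has_derivative_linear by blast
    have "norm (D z v) \<le> ?K * norm v" for v
    proof -
      have "D z v = (\<Sum>b\<in>B. inner v b *\<^sub>R D z b)"
        using arg_cong[OF B[of v], of "D z"] by (simp add: linear_sum[OF lin] linear_scale[OF lin])
      also have "norm \<dots> \<le> (\<Sum>b\<in>B. norm v * norm (D z b))"
      proof (intro order_trans[OF norm_sum] sum_mono)
        fix b assume "b \<in> B"
        then have "\<bar>inner v b\<bar> \<le> norm v" using Cauchy_Schwarz_ineq2[of v b] unit by simp
        then show "norm (inner v b *\<^sub>R D z b) \<le> norm v * norm (D z b)"
          by (simp add: mult_right_mono)
      qed
      also have "\<dots> \<le> norm v * ?K"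
        unfolding sum_distrib_left[symmetric] using d(3)[OF z] by (intro mult_left_mono) auto
      finally show ?thesis by (simp add: mult.commute)
    qed
    then show "onorm (D z) \<le> ?K" by (intro onorm_bound) (auto intro!: add_nonneg_nonneg sum_nonneg)
  qed
  then have "?K-lipschitz_on (cball y\<^sub>0 (d/2)) V"
    by (intro lipschitz_onI) (auto simp: dist_norm intro!: add_nonneg_nonneg sum_nonneg)
  moreover have "cball y\<^sub>0 (d/2) \<subseteq> S" using d(1,2) by (auto simp: dist_commute)
  ultimately show thesis using that[of "d/2"] d(1) by simp
qed

lemma smooth_ode_local_solution:
  fixes V :: "'a::finite_dim_inner \<Rightarrow> 'a"
  assumes "open S" "y\<^sub>0 \<in> S" "smooth_on S V"
  obtains \<epsilon> y where "0 < \<epsilon>" "y 0 = y\<^sub>0" "\<And>t. t \<in> {-\<epsilon><..<\<epsilon>} \<Longrightarrow> y t \<in> S"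
    "\<And>t. t \<in> {-\<epsilon><..<\<epsilon>} \<Longrightarrow> (y has_vector_derivative V (y t)) (at t)"
    "smooth_on {-\<epsilon><..<\<epsilon>} y"
proof -
  obtain r L where r: "0 < r" "cball y\<^sub>0 r \<subseteq> S" "L-lipschitz_on (cball y\<^sub>0 r) V"
    using smooth_on_imp_locally_lipschitz[OF assms] by blast
  obtain \<epsilon> y where y: "0 < \<epsilon>" "y 0 = y\<^sub>0" "\<And>t. t \<in> {-\<epsilon><..<\<epsilon>} \<Longrightarrow> y t \<in> cball y\<^sub>0 r"
    "\<And>t. t \<in> {-\<epsilon><..<\<epsilon>} \<Longrightarrow> (y has_vector_derivative V (y t)) (at t)"
    using picard_local_solution[OF r(1,3)] by blast
  have yS: "y t \<in> S" if "t \<in> {-\<epsilon><..<\<epsilon>}" for t using y(3)[OF that] r(2) by blast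
  have "Ck_on k {-\<epsilon><..<\<epsilon>} y" for k
  proof (induction k)
    case 0
    have "isCont y t" if "t \<in> {-\<epsilon><..<\<epsilon>}" for t
      using y(4)[OF that] by (rule has_vector_derivative_continuous)
    then show ?case by (simp add: continuous_at_imp_continuous_on)
  next
    case (Suc k)
    \<comment> \<open>The equation \<open>y' = V \<circ> y\<close> gains one derivative.\<close>
    have "Ck_on k {-\<epsilon><..<\<epsilon>} (\<lambda>t. V (y t))"
      using assms(3) yS by (intro Ck_on_compose[OF _ _ Suc, where T = S]) (auto simp: smooth_on_def)
    then have "Ck_on k {-\<epsilon><..<\<epsilon>} (\<lambda>t. h *\<^sub>R V (y t))" for h
      by (rule Ck_on_bounded_linear_compose[OF bounded_linear_scaleR_right open_greaterThanLessThan])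
    then show ?case
      using y(4) unfolding has_vector_derivative_def
      by (intro Ck_on_SucI[where D = "\<lambda>t h. h *\<^sub>R V (y t)"]) auto
  qed
  then show thesis using that[OF y(1,2) yS y(4)] by (simp add: smooth_on_def)
qed

section \<open>Smooth maps and derivatives in charts\<close>

abbreviation chart_inv :: "('m, 'e) chart \<Rightarrow> 'e \<Rightarrow> 'm" where
  "chart_inv c \<equiv> inv_into (fst c) (snd c)"

definition local_rep :: "('m, 'e) chart \<Rightarrow> ('n, 'f) chart \<Rightarrow> ('m \<Rightarrow> 'n) \<Rightarrow> 'e \<Rightarrow> 'f" where
  "local_rep c d f = snd d \<circ> f \<circ> chart_inv c"

text \<open>
  Derivatives and smoothness at a point are expressed in two explicitly named charts. The chain
  rule then only requires that the two maps use the same chart at the intermediate point, so that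
  changes of charts enter as derivatives of the identity map.
\<close>

definition chart_deriv ::
  "('m::t2_space, 'e::real_normed_vector) chart \<Rightarrow>
   ('n::t2_space, 'f::real_normed_vector) chart \<Rightarrow>
   ('m \<Rightarrow> 'n) \<Rightarrow> 'm \<Rightarrow> ('e \<Rightarrow> 'f) \<Rightarrow> bool" where
  "chart_deriv c d f p D \<longleftrightarrow> is_chart c \<and> is_chart d \<and> p \<in> fst c \<and> f p \<in> fst d \<and> isCont f p \<and>
     (local_rep c d f has_derivative D) (at (snd c p))"

definition smooth_at ::
  "('m::t2_space, 'e::real_normed_vector) chart \<Rightarrow>
   ('n::t2_space, 'f::real_normed_vector) chart \<Rightarrow> ('m \<Rightarrow> 'n) \<Rightarrow> 'm \<Rightarrow> bool" where
  "smooth_at c d f p \<longleftrightarrow> is_chart c \<and> is_chart d \<and>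
     (\<exists>N. open N \<and> p \<in> N \<and> N \<subseteq> fst c \<and> f ` N \<subseteq> fst d \<and> continuous_on N f \<and>
          smooth_on (snd c ` N) (local_rep c d f))"

text \<open>
  Only charts and a covering are asked for, over an arbitrary normed model space: this includes
  products with the dual of a Lie algebra, which carries an operator norm rather than an inner product.
\<close>

definition atlas :: "('m::t2_space, 'e::real_normed_vector) chart set \<Rightarrow> bool" where
  "atlas A \<longleftrightarrow> (\<forall>c\<in>A. is_chart c) \<and> (\<forall>p. \<exists>c\<in>A. p \<in> fst c)"

definition prod_chart :: "('m, 'e) chart \<Rightarrow> ('n, 'f) chart \<Rightarrow> ('m \<times> 'n, 'e \<times> 'f) chart" where
  "prod_chart c d = (fst c \<times> fst d, map_prod (snd c) (snd d))"

abbreviation vec_chart :: "('e, 'e) chart" where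
  "vec_chart \<equiv> (UNIV, id)"

subsection \<open>Charts\<close>

lemma is_chartD:
  assumes "is_chart c"
  shows "open (fst c)" "open (snd c ` fst c)"
    "homeomorphism (fst c) (snd c ` fst c) (snd c) (chart_inv c)"
  using assms by (auto simp: is_chart_def split_beta)

lemma chart_inv_chart: "is_chart c \<Longrightarrow> p \<in> fst c \<Longrightarrow> chart_inv c (snd c p) = p"
  using is_chartD(3) homeomorphism_apply1 by blast

lemma chart_chart_inv: "y \<in> snd c ` fst c \<Longrightarrow> snd c (chart_inv c y) = y"
  by (rule f_inv_into_f)

lemma chart_inv_in: "y \<in> snd c ` fst c \<Longrightarrow> chart_inv c y \<in> fst c"
  by (rule inv_into_into)

lemma chart_open_image:
  assumes "is_chart c" "open N" "N \<subseteq> fst c"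
  shows "open (snd c ` N)"
proof -
  have "openin (top_of_set (fst c)) N"
    using assms(2,3) by (simp add: open_subset)
  then show ?thesis
    using homeomorphism_imp_open_map[OF is_chartD(3)[OF assms(1)]]
      openin_open_trans[OF _ is_chartD(2)[OF assms(1)]] by blast
qed

lemma chart_continuous_on: "is_chart c \<Longrightarrow> continuous_on (fst c) (snd c)"
  using is_chartD(3)[of c] unfolding homeomorphism_def by blast

lemma chart_inv_continuous_on: "is_chart c \<Longrightarrow> continuous_on (snd c ` fst c) (chart_inv c)"
  using is_chartD(3)[of c] unfolding homeomorphism_def by blast

lemma is_chart_vec: "is_chart (vec_chart :: ('e::real_normed_vector, 'e) chart)"
proof -
  have "inv_into UNIV (id :: 'e \<Rightarrow> 'e) = id" by (simp add: inv_id)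
  then show ?thesis by (simp add: is_chart_def homeomorphism_def continuous_on_id' id_def)
qed

lemma fst_prod_chart: "fst (prod_chart c d) = fst c \<times> fst d"
  by (simp add: prod_chart_def)

lemma chart_inv_prod_chart:
  assumes "is_chart c" "is_chart d" "y \<in> snd c ` fst c" "z \<in> snd d ` fst d"
  shows "chart_inv (prod_chart c d) (y, z) = (chart_inv c y, chart_inv d z)"
proof (rule inv_into_f_eq)
  show "inj_on (snd (prod_chart c d)) (fst (prod_chart c d))"
    using assms(1,2) by (auto simp: prod_chart_def intro!: inj_onI) (metis chart_inv_chart)+
  show "(chart_inv c y, chart_inv d z) \<in> fst (prod_chart c d)"
    using assms by (simp add: prod_chart_def chart_inv_in)
  show "snd (prod_chart c d) (chart_inv c y, chart_inv d z) = (y, z)"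
    using assms by (simp add: prod_chart_def chart_chart_inv)
qed

lemma prod_chart_image: "snd (prod_chart c d) ` (N \<times> M) = snd c ` N \<times> snd d ` M"
  by (force simp: prod_chart_def)

lemma is_chart_prod_chart:
  assumes "is_chart c" "is_chart d"
  shows "is_chart (prod_chart c d)"
proof -
  let ?W = "snd c ` fst c \<times> snd d ` fst d"
  have im: "snd (prod_chart c d) ` fst (prod_chart c d) = ?W"
    using prod_chart_image[of c d "fst c" "fst d"] by (simp add: prod_chart_def)
  have "continuous_on (fst c \<times> fst d) (\<lambda>x. (snd c (fst x), snd d (snd x)))"
    using assms
    by (intro continuous_on_Pair continuous_on_compose2[OF chart_continuous_on]
        continuous_on_fst continuous_on_snd continuous_on_id) auto
  then have 1: "continuous_on (fst (prod_chart c d)) (snd (prod_chart c d))"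
    by (simp add: prod_chart_def map_prod_def split_beta)
  have "continuous_on ?W (\<lambda>x. (chart_inv c (fst x), chart_inv d (snd x)))"
    using assms
    by (intro continuous_on_Pair continuous_on_compose2[OF chart_inv_continuous_on]
        continuous_on_fst continuous_on_snd continuous_on_id) auto
  then have 2: "continuous_on ?W (chart_inv (prod_chart c d))"
    by (rule continuous_on_eq) (auto simp: chart_inv_prod_chart[OF assms])
  have "homeomorphism (fst (prod_chart c d)) ?W (snd (prod_chart c d)) (chart_inv (prod_chart c d))"
  proof (intro homeomorphismI 1 2)
    show "chart_inv (prod_chart c d) ` ?W \<subseteq> fst (prod_chart c d)"
      using im chart_inv_in[of _ "prod_chart c d"] by auto
    show "chart_inv (prod_chart c d) (snd (prod_chart c d) x) = x"
      if "x \<in> fst (prod_chart c d)" for x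
    proof (cases x)
      case (Pair p q)
      then have "p \<in> fst c" "q \<in> fst d" using that by (auto simp: prod_chart_def)
      then show ?thesis
        using chart_inv_prod_chart[OF assms, of "snd c p" "snd d q"] assms
        by (simp add: Pair chart_inv_chart prod_chart_def)
    qed
    show "snd (prod_chart c d) (chart_inv (prod_chart c d) y) = y" if "y \<in> ?W" for y
      using im that by (simp add: chart_chart_inv)
  qed (use im in auto)
  moreover have "open (fst (prod_chart c d))" "open ?W"
    using is_chartD[OF assms(1)] is_chartD[OF assms(2)] by (auto simp: prod_chart_def open_Times)
  ultimately show ?thesis by (simp add: is_chart_def split_beta im)
qed

subsection \<open>Derivatives in charts\<close>

lemma chart_deriv_nbhd:
  assumes "is_chart c" "is_chart d" "p \<in> fst c" "f p \<in> fst d" "isCont f p"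
  obtains N where "open N" "p \<in> N" "N \<subseteq> fst c" "f ` N \<subseteq> fst d"
proof -
  obtain M where M: "open M" "p \<in> M" "\<forall>x\<in>M. f x \<in> fst d"
    using assms(5) is_chartD(1)[OF assms(2)] assms(4) unfolding continuous_at_open by blast
  show thesis
    using that[OF open_Int[OF M(1) is_chartD(1)[OF assms(1)]]] M(2,3) assms(3) by blast
qed

lemma local_rep_chart: "is_chart c \<Longrightarrow> p \<in> fst c \<Longrightarrow> local_rep c d f (snd c p) = snd d (f p)"
  by (simp add: local_rep_def chart_inv_chart)

lemma chart_deriv_unique: "chart_deriv c d f p D \<Longrightarrow> chart_deriv c d f p E \<Longrightarrow> D = E"
  unfolding chart_deriv_def using has_derivative_unique by blast

lemma chart_deriv_linear: "chart_deriv c d f p D \<Longrightarrow> linear D"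
  unfolding chart_deriv_def using has_derivative_linear by blast

lemma chart_deriv_const:
  assumes "is_chart c" "is_chart d" "p \<in> fst c" "q \<in> fst d"
  shows "chart_deriv c d (\<lambda>_. q) p (\<lambda>_. 0)"
  using assms by (auto simp: chart_deriv_def local_rep_def o_def)

lemma chart_deriv_id:
  assumes "is_chart c" "p \<in> fst c"
  shows "chart_deriv c c (\<lambda>x. x) p (\<lambda>v. v)"
proof -
  have "(local_rep c c (\<lambda>x. x) has_derivative (\<lambda>v. v)) (at (snd c p))"
    by (rule has_derivative_transform_within_open[OF has_derivative_ident is_chartD(2)])
      (use assms in \<open>auto simp: local_rep_chart\<close>)
  then show ?thesis using assms by (simp add: chart_deriv_def)
qed

lemma chart_deriv_compose:
  assumes f: "chart_deriv c d f p D" and g: "chart_deriv d e g (f p) E"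
  shows "chart_deriv c e (\<lambda>x. g (f x)) p (\<lambda>v. E (D v))"
proof -
  have c: "is_chart c" "p \<in> fst c" and d: "is_chart d" "f p \<in> fst d" and cont: "isCont f p"
    using f by (auto simp: chart_deriv_def)
  obtain N where N: "open N" "p \<in> N" "N \<subseteq> fst c" "f ` N \<subseteq> fst d"
    using chart_deriv_nbhd[OF c(1) d(1) c(2) d(2) cont] .
  have Df: "(local_rep c d f has_derivative D) (at (snd c p))"
    using f by (simp add: chart_deriv_def)
  have Dg: "(local_rep d e g has_derivative E) (at (local_rep c d f (snd c p)))"
    unfolding local_rep_chart[OF c] using g by (simp add: chart_deriv_def)
  note has_derivative_compose[OF Df Dg]
  from this have "(local_rep c e (\<lambda>x. g (f x)) has_derivative (\<lambda>v. E (D v))) (at (snd c p))"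
  proof (rule has_derivative_transform_within_open)
    show "open (snd c ` N)" by (rule chart_open_image[OF c(1) N(1,3)])
    show "local_rep d e g (local_rep c d f y) = local_rep c e (\<lambda>x. g (f x)) y"
      if "y \<in> snd c ` N" for y
      using that N c d by (auto simp: local_rep_chart subset_iff)
  qed (use N in auto)
  moreover have "isCont (\<lambda>x. g (f x)) p"
    using g by (intro isCont_o2[OF cont]) (simp add: chart_deriv_def)
  ultimately show ?thesis
    using f g unfolding chart_deriv_def by blast
qed

lemma local_rep_Pair:
  "local_rep a (prod_chart c d) (\<lambda>x. (f x, g x)) = (\<lambda>y. (local_rep a c f y, local_rep a d g y))"
  by (simp add: local_rep_def prod_chart_def fun_eq_iff)

lemma chart_deriv_Pair:
  assumes "chart_deriv a c f p D" "chart_deriv a d g p E"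
  shows "chart_deriv a (prod_chart c d) (\<lambda>x. (f x, g x)) p (\<lambda>v. (D v, E v))"
proof -
  have "(local_rep a (prod_chart c d) (\<lambda>x. (f x, g x)) has_derivative (\<lambda>v. (D v, E v)))
      (at (snd a p))"
    unfolding local_rep_Pair using assms by (intro has_derivative_Pair) (simp_all add: chart_deriv_def)
  moreover have "isCont (\<lambda>x. (f x, g x)) p"
    using assms by (intro continuous_Pair) (simp_all add: chart_deriv_def)
  ultimately show ?thesis
    using assms is_chart_prod_chart[of c d] by (simp add: chart_deriv_def fst_prod_chart)
qed

subsection \<open>Smoothness in charts\<close>

lemma smooth_atI:
  assumes "is_chart c" "is_chart d" "open N" "p \<in> N" "N \<subseteq> fst c" "f ` N \<subseteq> fst d"
    "continuous_on N f" "smooth_on (snd c ` N) (local_rep c d f)"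
  shows "smooth_at c d f p"
  unfolding smooth_at_def using assms by blast

lemma smooth_at_imp_chart_deriv:
  assumes "smooth_at c d f p"
  shows "chart_deriv c d f p (frechet_derivative (local_rep c d f) (at (snd c p)))"
proof -
  obtain N where N: "is_chart c" "is_chart d" "open N" "p \<in> N" "N \<subseteq> fst c" "f ` N \<subseteq> fst d"
    "continuous_on N f" "smooth_on (snd c ` N) (local_rep c d f)"
    using assms unfolding smooth_at_def by blast
  have "isCont f p" using N(3,4,7) by (simp add: continuous_on_eq_continuous_at)
  moreover have "(local_rep c d f has_derivative frechet_derivative (local_rep c d f) (at (snd c p)))
      (at (snd c p))"
    using smooth_on_imp_has_derivative[OF N(8) imageI[OF N(4)]] .
  ultimately show ?thesis using N(1,2,4,5,6) unfolding chart_deriv_def by blast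
qed

lemma smooth_at_const:
  assumes "is_chart c" "is_chart d" "p \<in> fst c" "q \<in> fst d"
  shows "smooth_at c d (\<lambda>_. q) p"
  using assms is_chartD[OF assms(1)]
  by (intro smooth_atI[of c d "fst c"]) (auto simp: local_rep_def o_def smooth_on_const)

lemma smooth_at_compose:
  fixes d :: "('n::t2_space, 'f::finite_dim_inner) chart"
  assumes "smooth_at c d f p" "smooth_at d e g (f p)"
  shows "smooth_at c e (\<lambda>x. g (f x)) p"
proof -
  obtain N where N: "is_chart c" "is_chart d" "open N" "p \<in> N" "N \<subseteq> fst c" "f ` N \<subseteq> fst d"
    "continuous_on N f" "smooth_on (snd c ` N) (local_rep c d f)"
    using assms(1) unfolding smooth_at_def by blast
  obtain M where M: "is_chart e" "open M" "f p \<in> M" "M \<subseteq> fst d" "g ` M \<subseteq> fst e"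
    "continuous_on M g" "smooth_on (snd d ` M) (local_rep d e g)"
    using assms(2) unfolding smooth_at_def by blast
  define P where "P = N \<inter> f -` M"
  have "open P" unfolding P_def by (rule continuous_open_preimage[OF N(7,3) M(2)])
  then have P: "open P" "p \<in> P" "P \<subseteq> N" "f ` P \<subseteq> M"
    using N(4) M(3) by (auto simp: P_def)
  have oP: "open (snd c ` P)" using P(3) N(5) by (intro chart_open_image[OF N(1) P(1)]) auto
  have rep: "local_rep c d f y \<in> snd d ` M \<and>
      local_rep d e g (local_rep c d f y) = local_rep c e (\<lambda>x. g (f x)) y"
    if y: "y \<in> snd c ` P" for y
  proof -
    obtain x where x: "x \<in> P" "y = snd c x" using y by blast
    then have "x \<in> fst c" "f x \<in> M" "f x \<in> fst d" using P(3,4) N(5) M(4) by auto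
    then show ?thesis using x N(1,2) by (simp add: local_rep_chart)
  qed
  have "smooth_on (snd c ` P) (\<lambda>y. local_rep d e g (local_rep c d f y))"
    by (rule smooth_on_compose[OF oP _ smooth_on_subset[OF N(8) image_mono[OF P(3)]] M(7)])
      (use rep in auto)
  then have "smooth_on (snd c ` P) (local_rep c e (\<lambda>x. g (f x)))"
    by (rule smooth_on_cong[OF oP, rotated]) (use rep in auto)
  moreover have "continuous_on P (\<lambda>x. g (f x))"
    using continuous_on_compose2[OF M(6) continuous_on_subset[OF N(7) P(3)] P(4)] .
  moreover have "P \<subseteq> fst c" "(\<lambda>x. g (f x)) ` P \<subseteq> fst e"
    using P(3,4) N(5) M(5) by blast+
  ultimately show ?thesis using smooth_atI[OF N(1) M(1) P(1,2)] by blast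
qed

lemma smooth_at_Pair:
  assumes "smooth_at a c f p" "smooth_at a d g p"
  shows "smooth_at a (prod_chart c d) (\<lambda>x. (f x, g x)) p"
proof -
  obtain N where N: "is_chart a" "is_chart c" "open N" "p \<in> N" "N \<subseteq> fst a" "f ` N \<subseteq> fst c"
    "continuous_on N f" "smooth_on (snd a ` N) (local_rep a c f)"
    using assms(1) unfolding smooth_at_def by blast
  obtain M where M: "is_chart d" "open M" "p \<in> M" "M \<subseteq> fst a" "g ` M \<subseteq> fst d"
    "continuous_on M g" "smooth_on (snd a ` M) (local_rep a d g)"
    using assms(2) unfolding smooth_at_def by blast
  have oP: "open (snd a ` (N \<inter> M))" using N(5) by (intro chart_open_image[OF N(1) open_Int[OF N(3) M(2)]]) auto
  have "smooth_on (snd a ` (N \<inter> M)) (local_rep a (prod_chart c d) (\<lambda>x. (f x, g x)))"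
    unfolding local_rep_Pair
    by (intro smooth_on_Pair oP smooth_on_subset[OF N(8)] smooth_on_subset[OF M(7)]) auto
  moreover have "continuous_on (N \<inter> M) (\<lambda>x. (f x, g x))"
    by (intro continuous_on_Pair continuous_on_subset[OF N(7)] continuous_on_subset[OF M(6)]) auto
  moreover have "(\<lambda>x. (f x, g x)) ` (N \<inter> M) \<subseteq> fst (prod_chart c d)"
    using N(6) M(5) by (auto simp: fst_prod_chart)
  ultimately show ?thesis
    using smooth_atI[OF N(1) is_chart_prod_chart[OF N(2) M(1)] open_Int[OF N(3) M(2)]] N(4,5) M(3)
    by blast
qed

lemma smooth_at_fst:
  assumes "is_chart c" "is_chart d" "p \<in> fst c" "q \<in> fst d"
  shows "smooth_at (prod_chart c d) c fst (p, q)"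
proof -
  have o: "open (snd c ` fst c \<times> snd d ` fst d)"
    using open_Times is_chartD(2)[OF assms(1)] is_chartD(2)[OF assms(2)] by blast
  have "smooth_on (snd c ` fst c \<times> snd d ` fst d) (local_rep (prod_chart c d) c fst)"
    by (rule smooth_on_cong[OF o _ smooth_on_bounded_linear[OF bounded_linear_fst o]])
      (auto simp: local_rep_def chart_inv_prod_chart[OF assms(1,2)] chart_chart_inv)
  then have "smooth_on (snd (prod_chart c d) ` (fst c \<times> fst d)) (local_rep (prod_chart c d) c fst)"
    unfolding prod_chart_image .
  moreover have "open (fst c \<times> fst d)"
    using open_Times is_chartD(1)[OF assms(1)] is_chartD(1)[OF assms(2)] by blast
  moreover have "continuous_on (fst c \<times> fst d) fst"
    by (intro continuous_on_fst continuous_on_id)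
  ultimately show ?thesis
    using assms is_chart_prod_chart[OF assms(1,2)]
    by (intro smooth_atI[of _ _ "fst c \<times> fst d"]) (auto simp: fst_prod_chart)
qed

lemma smooth_at_snd:
  assumes "is_chart c" "is_chart d" "p \<in> fst c" "q \<in> fst d"
  shows "smooth_at (prod_chart c d) d snd (p, q)"
proof -
  have o: "open (snd c ` fst c \<times> snd d ` fst d)"
    using open_Times is_chartD(2)[OF assms(1)] is_chartD(2)[OF assms(2)] by blast
  have "smooth_on (snd c ` fst c \<times> snd d ` fst d) (local_rep (prod_chart c d) d snd)"
    by (rule smooth_on_cong[OF o _ smooth_on_bounded_linear[OF bounded_linear_snd o]])
      (auto simp: local_rep_def chart_inv_prod_chart[OF assms(1,2)] chart_chart_inv)
  then have "smooth_on (snd (prod_chart c d) ` (fst c \<times> fst d)) (local_rep (prod_chart c d) d snd)"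
    unfolding prod_chart_image .
  moreover have "open (fst c \<times> fst d)"
    using open_Times is_chartD(1)[OF assms(1)] is_chartD(1)[OF assms(2)] by blast
  moreover have "continuous_on (fst c \<times> fst d) snd"
    by (intro continuous_on_snd continuous_on_id)
  ultimately show ?thesis
    using assms is_chart_prod_chart[OF assms(1,2)]
    by (intro smooth_atI[of _ _ "fst c \<times> fst d"]) (auto simp: fst_prod_chart)
qed

lemma (in smooth_manifold) smooth_at_chart_change:
  assumes "c \<in> A" "c' \<in> A" "p \<in> fst c" "p \<in> fst c'"
  shows "smooth_at c c' (\<lambda>x. x) p"
proof -
  have "smooth_on (snd c ` (fst c \<inter> fst c')) (local_rep c c' (\<lambda>x. x))"
    using compatible[of "fst c" "snd c" "fst c'" "snd c'"] assms by (simp add: local_rep_def comp_def)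
  moreover have "open (fst c \<inter> fst c')"
    using open_Int is_chartD(1)[OF charts[OF assms(1)]] is_chartD(1)[OF charts[OF assms(2)]] by blast
  ultimately show ?thesis
    using assms charts by (intro smooth_atI[of _ _ "fst c \<inter> fst c'"]) auto
qed

lemma smooth_at_cong:
  assumes f: "smooth_at c d f p" and M: "open M" "p \<in> M" "\<And>x. x \<in> M \<Longrightarrow> f x = g x"
  shows "smooth_at c d g p"
proof -
  obtain N where N: "is_chart c" "is_chart d" "open N" "p \<in> N" "N \<subseteq> fst c" "f ` N \<subseteq> fst d"
    "continuous_on N f" "smooth_on (snd c ` N) (local_rep c d f)"
    using f unfolding smooth_at_def by blast
  have sub: "N \<inter> M \<subseteq> fst c" using N(5) by blast
  have o: "open (snd c ` (N \<inter> M))" by (rule chart_open_image[OF N(1) open_Int[OF N(3) M(1)] sub])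
  show ?thesis
  proof (rule smooth_atI[OF N(1,2) open_Int[OF N(3) M(1)] _ sub])
    show "p \<in> N \<inter> M" using N(4) M(2) by simp
    show "g ` (N \<inter> M) \<subseteq> fst d" using N(6) M(3) by fastforce
    show "continuous_on (N \<inter> M) g"
      using continuous_on_subset[OF N(7) Int_lower1] by (rule continuous_on_eq) (simp add: M(3))
    have "smooth_on (snd c ` (N \<inter> M)) (local_rep c d f)"
      by (rule smooth_on_subset[OF N(8)]) blast
    then show "smooth_on (snd c ` (N \<inter> M)) (local_rep c d g)"
    proof (rule smooth_on_cong[OF o, rotated])
      fix y assume "y \<in> snd c ` (N \<inter> M)"
      then obtain x where x: "x \<in> N \<inter> M" "y = snd c x" by blast
      then have "x \<in> fst c" using sub by blast
      then show "local_rep c d f y = local_rep c d g y"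
        using x M(3) by (simp add: local_rep_chart[OF N(1)])
    qed
  qed
qed

lemma chart_deriv_cong:
  assumes f: "chart_deriv c d f p D" and M: "open M" "p \<in> M" "\<And>x. x \<in> M \<Longrightarrow> f x = g x"
  shows "chart_deriv c d g p D"
proof -
  have c: "is_chart c" "p \<in> fst c" and d: "is_chart d" "f p \<in> fst d"
    using f by (simp_all add: chart_deriv_def)
  have sub: "fst c \<inter> M \<subseteq> fst c" by blast
  have "(local_rep c d f has_derivative D) (at (snd c p))" using f by (simp add: chart_deriv_def)
  then have "(local_rep c d g has_derivative D) (at (snd c p))"
  proof (rule has_derivative_transform_within_open)
    show "open (snd c ` (fst c \<inter> M))"
      by (rule chart_open_image[OF c(1) open_Int[OF is_chartD(1)[OF c(1)] M(1)] sub])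
    show "snd c p \<in> snd c ` (fst c \<inter> M)" using c(2) M(2) by blast
    fix y assume "y \<in> snd c ` (fst c \<inter> M)"
    then obtain x where "x \<in> fst c" "x \<in> M" "y = snd c x" by blast
    then show "local_rep c d f y = local_rep c d g y"
      using M(3) by (simp add: local_rep_chart[OF c(1)])
  qed
  moreover have "isCont g p"
  proof -
    have "\<forall>\<^sub>F x in nhds p. f x = g x"
      using M eventually_nhds by blast
    then show ?thesis using f isCont_cong[of f g p] by (simp add: chart_deriv_def)
  qed
  ultimately show ?thesis using c d M(2,3) by (simp add: chart_deriv_def)
qed

subsection \<open>Smooth maps between manifolds\<close>

lemma (in smooth_manifold) atlas: "atlas A"
  using charts covers by (auto simp: atlas_def split_beta)

lemma atlas_vec_atlas: "atlas vec_atlas"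
  by (simp add: atlas_def vec_atlas_def is_chart_vec)

lemma prod_atlas_eq: "prod_atlas A B = {prod_chart c d |c d. c \<in> A \<and> d \<in> B}"
  by (force simp: prod_atlas_def prod_chart_def image_iff)

lemma prod_chart_in_prod_atlas: "c \<in> A \<Longrightarrow> d \<in> B \<Longrightarrow> prod_chart c d \<in> prod_atlas A B"
  unfolding prod_atlas_eq by blast

lemma atlas_prod_atlas:
  assumes "atlas A" "atlas B"
  shows "atlas (prod_atlas A B)"
proof -
  have "\<exists>c\<in>prod_atlas A B. p \<in> fst c" for p
  proof -
    obtain c d where "c \<in> A" "fst p \<in> fst c" "d \<in> B" "snd p \<in> fst d"
      using assms unfolding atlas_def by metis
    then have "prod_chart c d \<in> prod_atlas A B" "p \<in> fst (prod_chart c d)"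
      by (auto simp: prod_atlas_eq fst_prod_chart mem_Times_iff simp del: split_paired_Ex)
    then show ?thesis by blast
  qed
  moreover have "is_chart e" if "e \<in> prod_atlas A B" for e
    using that assms is_chart_prod_chart unfolding atlas_def prod_atlas_eq by blast
  ultimately show ?thesis unfolding atlas_def by blast
qed

lemma chart_at_in: "atlas A \<Longrightarrow> chart_at A p \<in> A \<and> p \<in> fst (chart_at A p)"
  unfolding chart_at_def atlas_def by (rule someI_ex) blast

lemma chart_at_vec_atlas: "chart_at vec_atlas p = vec_chart"
  using chart_at_in[OF atlas_vec_atlas, of p] by (simp add: vec_atlas_def)

lemma smooth_map_imp_smooth_at:
  assumes "atlas A" "atlas B" "smooth_map A B f" "c \<in> A" "d \<in> B" "p \<in> fst c" "f p \<in> fst d"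
  shows "smooth_at c d f p"
proof -
  have cont: "continuous_on UNIV f" and
    "smooth_on (snd c ` (fst c \<inter> f -` fst d)) (local_rep c d f)"
    using assms(3-5) unfolding smooth_map_def local_rep_def by (auto simp: split_beta)
  moreover have "is_chart c" "is_chart d" using assms by (auto simp: atlas_def)
  moreover have "open (f -` fst d)"
    using cont is_chartD(1)[OF \<open>is_chart d\<close>] by (simp add: continuous_on_open_vimage)
  moreover from this have "open (fst c \<inter> f -` fst d)"
    using is_chartD(1)[OF \<open>is_chart c\<close>] by (intro open_Int)
  ultimately show ?thesis
    using assms(6,7) continuous_on_subset[OF cont subset_UNIV]
    by (intro smooth_atI[of _ _ "fst c \<inter> f -` fst d"]) auto
qed

lemma smooth_mapI:
  assumes "atlas A" "atlas B"
    and "\<And>c d p. c \<in> A \<Longrightarrow> d \<in> B \<Longrightarrow> p \<in> fst c \<Longrightarrow> f p \<in> fst d \<Longrightarrow> smooth_at c d f p"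
  shows "smooth_map A B f"
proof -
  have cont: "isCont f p" for p
  proof -
    obtain c d where "c \<in> A" "p \<in> fst c" "d \<in> B" "f p \<in> fst d"
      using assms(1,2) unfolding atlas_def by metis
    then have "smooth_at c d f p" by (intro assms(3))
    then show ?thesis using smooth_at_imp_chart_deriv unfolding chart_deriv_def by blast
  qed
  have smooth: "smooth_on (snd c ` (fst c \<inter> f -` fst d)) (snd d \<circ> f \<circ> chart_inv c)"
    if cd: "c \<in> A" "d \<in> B" for c d
  proof (rule smooth_on_local)
    fix y assume "y \<in> snd c ` (fst c \<inter> f -` fst d)"
    then obtain p where p: "y = snd c p" "p \<in> fst c" "f p \<in> fst d" by auto
    obtain N where N: "is_chart c" "open N" "p \<in> N" "N \<subseteq> fst c"
      "smooth_on (snd c ` N) (local_rep c d f)"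
      using assms(3)[OF cd p(2,3)] unfolding smooth_at_def by blast
    show "\<exists>T. open T \<and> y \<in> T \<and> smooth_on T (snd d \<circ> f \<circ> chart_inv c)"
      using chart_open_image[OF N(1,2,4)] N(3,5) unfolding p(1) local_rep_def by blast
  qed
  have "continuous_on UNIV f" using cont by (intro continuous_at_imp_continuous_on) blast
  then show ?thesis
    unfolding smooth_map_def case_prod_beta by (intro conjI ballI smooth)
qed

lemma smooth_map_compose:
  fixes B :: "('n::t2_space, 'f::finite_dim_inner) chart set"
  assumes "atlas A" "atlas B" "atlas C" "smooth_map A B f" "smooth_map B C g"
  shows "smooth_map A C (\<lambda>x. g (f x))"
proof (rule smooth_mapI[OF assms(1,3)])
  fix c d p assume c: "c \<in> A" "p \<in> fst c" and d: "d \<in> C" "g (f p) \<in> fst d"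
  obtain b where b: "b \<in> B" "f p \<in> fst b" using chart_at_in[OF assms(2)] by blast
  show "smooth_at c d (\<lambda>x. g (f x)) p"
    using smooth_at_compose[OF smooth_map_imp_smooth_at[OF assms(1,2,4) c(1) b(1) c(2) b(2)]
        smooth_map_imp_smooth_at[OF assms(2,3,5) b(1) d(1) b(2) d(2)]] .
qed

lemma smooth_map_Pair:
  assumes "atlas A" "atlas B" "atlas C" "smooth_map A B f" "smooth_map A C g"
  shows "smooth_map A (prod_atlas B C) (\<lambda>x. (f x, g x))"
proof (rule smooth_mapI[OF assms(1) atlas_prod_atlas[OF assms(2,3)]])
  fix c d p assume *: "c \<in> A" "d \<in> prod_atlas B C" "p \<in> fst c" "(f p, g p) \<in> fst d"
  then obtain b e where be: "d = prod_chart b e" "b \<in> B" "e \<in> C" unfolding prod_atlas_eq by blast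
  then have fg: "f p \<in> fst b" "g p \<in> fst e" using *(4) by (auto simp: fst_prod_chart)
  show "smooth_at c d (\<lambda>x. (f x, g x)) p" unfolding be(1)
    using smooth_at_Pair[OF smooth_map_imp_smooth_at[OF assms(1,2,4) *(1) be(2) *(3) fg(1)]
        smooth_map_imp_smooth_at[OF assms(1,3,5) *(1) be(3) *(3) fg(2)]] .
qed

lemma smooth_map_const: "atlas A \<Longrightarrow> atlas B \<Longrightarrow> smooth_map A B (\<lambda>_. q)"
  by (rule smooth_mapI, assumption, assumption, rule smooth_at_const) (unfold atlas_def, blast+)

lemma (in smooth_manifold) smooth_map_id: "smooth_map A A (\<lambda>x. x)"
  by (rule smooth_mapI[OF atlas atlas]) (rule smooth_at_chart_change)

lemma smooth_map_fst:
  assumes "smooth_manifold A" "atlas B"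
  shows "smooth_map (prod_atlas A B) A fst"
proof (rule smooth_mapI)
  interpret smooth_manifold A by fact
  show "atlas (prod_atlas A B)" "atlas A" using atlas assms(2) by (auto intro: atlas_prod_atlas)
  fix e d p assume *: "e \<in> prod_atlas A B" "d \<in> A" "p \<in> fst e" "fst p \<in> fst d"
  then obtain b c where bc: "e = prod_chart b c" "b \<in> A" "c \<in> B" unfolding prod_atlas_eq by blast
  then have p: "fst p \<in> fst b" "snd p \<in> fst c" using * by (auto simp: fst_prod_chart mem_Times_iff)
  have "is_chart b" "is_chart c" using bc charts assms(2) unfolding atlas_def by blast+
  from smooth_at_compose[OF smooth_at_fst[OF this p]] smooth_at_chart_change[OF bc(2) *(2) p(1) *(4)]
  show "smooth_at e d fst p" by (simp add: bc(1))
qed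

lemma smooth_map_snd:
  assumes "atlas A" "smooth_manifold B"
  shows "smooth_map (prod_atlas A B) B snd"
proof (rule smooth_mapI)
  interpret smooth_manifold B by fact
  show "atlas (prod_atlas A B)" "atlas B" using atlas assms(1) by (auto intro: atlas_prod_atlas)
  fix e d p assume *: "e \<in> prod_atlas A B" "d \<in> B" "p \<in> fst e" "snd p \<in> fst d"
  then obtain b c where bc: "e = prod_chart b c" "b \<in> A" "c \<in> B" unfolding prod_atlas_eq by blast
  then have p: "fst p \<in> fst b" "snd p \<in> fst c" using * by (auto simp: fst_prod_chart mem_Times_iff)
  have "is_chart b" "is_chart c" using bc charts assms(1) unfolding atlas_def by blast+
  from smooth_at_compose[OF smooth_at_snd[OF this p]] smooth_at_chart_change[OF bc(3) *(2) p(2) *(4)]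
  show "smooth_at e d snd p" by (simp add: bc(1))
qed

lemma smooth_manifold_vec_atlas:
  "smooth_manifold (vec_atlas :: ('e::{finite_dim_inner, second_countable_topology}, 'e) chart set)"
  by standard (auto simp: vec_atlas_def is_chart_vec inv_id intro: smooth_on_ident[unfolded id_def[symmetric]])

subsection \<open>Tangent maps and velocities\<close>

lemma tangent_map_eqI:
  assumes "chart_deriv (chart_at A p) (chart_at B (f p)) f p D"
  shows "tangent_map A B f p = D"
proof -
  have "(local_rep (chart_at A p) (chart_at B (f p)) f has_derivative D) (at (snd (chart_at A p) p))"
    using assms by (simp only: chart_deriv_def)
  then show ?thesis
    using frechet_derivative_at by (fastforce simp: tangent_map_def local_rep_def Let_def split_beta)
qed

lemma chart_deriv_tangent_map:
  assumes "atlas A" "atlas B" "smooth_map A B f"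
  shows "chart_deriv (chart_at A p) (chart_at B (f p)) f p (tangent_map A B f p)"
proof -
  have "smooth_at (chart_at A p) (chart_at B (f p)) f p"
    using chart_at_in[OF assms(1), of p] chart_at_in[OF assms(2), of "f p"]
    by (intro smooth_map_imp_smooth_at[OF assms]) auto
  note D = smooth_at_imp_chart_deriv[OF this]
  show ?thesis unfolding tangent_map_eqI[of A p B f, OF D] by (rule D)
qed

lemma local_rep_vec_chart: "local_rep vec_chart c \<gamma> = snd c \<circ> \<gamma>"
  by (simp add: local_rep_def inv_id)

lemma velocity_eqI:
  assumes "chart_deriv vec_chart (chart_at A (\<gamma> s)) \<gamma> s (\<lambda>h. h *\<^sub>R v)"
  shows "velocity A \<gamma> s = v"
proof -
  have "(snd (chart_at A (\<gamma> s)) \<circ> \<gamma> has_vector_derivative v) (at s)"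
    using assms by (simp add: chart_deriv_def local_rep_vec_chart has_vector_derivative_def)
  then show ?thesis unfolding velocity_def by (rule vector_derivative_at)
qed

lemma chart_deriv_velocity:
  assumes "atlas A" "smooth_map vec_atlas A \<gamma>"
  shows "chart_deriv vec_chart (chart_at A (\<gamma> s)) \<gamma> s (\<lambda>h. h *\<^sub>R velocity A \<gamma> s)"
proof -
  obtain D where D: "chart_deriv vec_chart (chart_at A (\<gamma> s)) \<gamma> s D"
    using chart_deriv_tangent_map[OF atlas_vec_atlas assms, of s] unfolding chart_at_vec_atlas by blast
  have "D = (\<lambda>h. h *\<^sub>R D 1)"
  proof
    show "D h = h *\<^sub>R D 1" for h
      using linear_scale[OF chart_deriv_linear[OF D], of h 1] by simp
  qed
  from subst[of D _ "chart_deriv vec_chart (chart_at A (\<gamma> s)) \<gamma> s", OF this D]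
  have D': "chart_deriv vec_chart (chart_at A (\<gamma> s)) \<gamma> s (\<lambda>h. h *\<^sub>R D 1)" .
  show ?thesis unfolding velocity_eqI[OF D'] by (rule D')
qed

text \<open>
  In fixed charts the mean value theorem on a small ball gives local constancy. The charts in
  which the derivative is known to vanish may vary with the point; by the chain rule with the
  identity map it then vanishes in the fixed charts as well.
\<close>

lemma zero_derivative_imp_constant:
  assumes A: "smooth_manifold A" and B: "smooth_manifold B" and S: "open S" "connected S"
    and deriv: "\<And>p. p \<in> S \<Longrightarrow> \<exists>c\<in>A. \<exists>d\<in>B. chart_deriv c d f p (\<lambda>_. 0)"
    and pq: "p \<in> S" "q \<in> S"
  shows "f p = f q"
proof -
  have cont: "continuous_on S f"
    using deriv unfolding chart_deriv_def by (intro continuous_at_imp_continuous_on) blast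
  have zero: "chart_deriv c d f x (\<lambda>_. 0)"
    if c: "c \<in> A" "x \<in> fst c" and d: "d \<in> B" "f x \<in> fst d" and x: "x \<in> S" for c d x
  proof -
    obtain c' d' where c': "c' \<in> A" "x \<in> fst c'" and d': "d' \<in> B" "f x \<in> fst d'"
      and f: "chart_deriv c' d' f x (\<lambda>_. 0)"
      using deriv[OF x] unfolding chart_deriv_def by blast
    note c'c = smooth_at_imp_chart_deriv[OF
        smooth_manifold.smooth_at_chart_change[OF A c(1) c'(1) c(2) c'(2)]]
      and d'd = smooth_at_imp_chart_deriv[OF
        smooth_manifold.smooth_at_chart_change[OF B d'(1) d(1) d'(2) d(2)]]
    from chart_deriv_compose[OF chart_deriv_compose[OF c'c f] d'd]
    show ?thesis using linear_0[OF chart_deriv_linear[OF d'd]] by simp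
  qed
  have loc: "\<exists>N. open N \<and> x \<in> N \<and> (\<forall>y\<in>N. f x = f y)" if x: "x \<in> S" for x
  proof -
    obtain c d where c: "c \<in> A" "x \<in> fst c" and d: "d \<in> B" "f x \<in> fst d"
      using deriv[OF x] unfolding chart_deriv_def by blast
    have chc: "is_chart c" and chd: "is_chart d"
      using c(1) d(1) A B smooth_manifold.charts by blast+
    define N where "N = (S \<inter> f -` fst d) \<inter> fst c"
    have oN: "open N" unfolding N_def
      by (intro open_Int continuous_open_preimage[OF cont S(1)] is_chartD(1) chc chd)
    have xN: "x \<in> N" using x c(2) d(2) by (simp add: N_def)
    have "open (snd c ` N)" by (intro chart_open_image chc oN) (auto simp: N_def)
    then obtain r where r: "0 < r" "ball (snd c x) r \<subseteq> snd c ` N"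
      using xN open_contains_ball by blast
    have "\<exists>k. \<forall>y\<in>ball (snd c x) r. local_rep c d f y = k"
    proof (rule has_derivative_zero_constant[OF convex_ball])
      fix y assume "y \<in> ball (snd c x) r"
      then obtain z where z: "z \<in> N" "y = snd c z" using r(2) by blast
      have "chart_deriv c d f z (\<lambda>_. 0)"
        using z(1) by (intro zero c d) (auto simp: N_def)
      then have "(local_rep c d f has_derivative (\<lambda>_. 0)) (at y)"
        unfolding z(2) by (simp only: chart_deriv_def)
      then show "(local_rep c d f has_derivative (\<lambda>_. 0)) (at y within ball (snd c x) r)"
        by (rule has_derivative_at_withinI)
    qed
    then obtain k where k: "\<And>y. y \<in> ball (snd c x) r \<Longrightarrow> local_rep c d f y = k" by blast
    define M where "M = N \<inter> snd c -` ball (snd c x) r"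
    have "N \<subseteq> fst c" by (auto simp: N_def)
    then have oM: "open M" unfolding M_def
      by (rule continuous_open_preimage[OF continuous_on_subset[OF chart_continuous_on[OF chc]]
            oN open_ball])
    have xM: "x \<in> M" using xN r(1) by (simp add: M_def)
    have "snd d (f y) = k" if "y \<in> M" for y
    proof -
      have y: "y \<in> fst c" "snd c y \<in> ball (snd c x) r" using that by (simp_all add: M_def N_def)
      show ?thesis using k[OF y(2)] local_rep_chart[OF chc y(1), of d f] by simp
    qed
    then have "f y = chart_inv d k" if "y \<in> M" for y
      using chart_inv_chart[OF chd, of "f y"] that by (simp add: M_def N_def)
    then show ?thesis using oM xM by metis
  qed
  show ?thesis
  proof (rule connected_local_const[OF S(2) pq], rule ballI)
    fix x assume "x \<in> S"
    then obtain N where "open N" "x \<in> N" "\<forall>y\<in>N. f x = f y" using loc by blast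
    then show "\<forall>\<^sub>F y in at x within S. f x = f y"
      unfolding eventually_at_topological by blast
  qed
qed

text \<open>
  A partial derivative of a smooth map on a product is a directional derivative of its
  local representative, hence smooth in the remaining variable.
\<close>

lemma smooth_partial_derivative:
  fixes A :: "('m::t2_space, 'e::finite_dim_inner) chart set"
    and B :: "('n::t2_space, 'f::finite_dim_inner) chart set"
  assumes at: "atlas A" "atlas B" "atlas C"
    and F: "smooth_map (prod_atlas A B) C (\<lambda>(p, q). F p q)"
    and c: "c \<in> A" and d: "d \<in> B" "q \<in> fst d" and e: "e \<in> C"
    and N: "open N" "N \<subseteq> fst c" "\<And>p. p \<in> N \<Longrightarrow> F p q \<in> fst e"
  shows "smooth_on (snd c ` N)
    (\<lambda>y. frechet_derivative (local_rep d e (F (chart_inv c y))) (at (snd d q)) v)"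
    and "\<And>p. p \<in> N \<Longrightarrow> chart_deriv d e (F p) q
      (frechet_derivative (local_rep d e (F p)) (at (snd d q)))"
proof -
  have chc: "is_chart c" and chd: "is_chart d" and che: "is_chart e"
    using at c d e unfolding atlas_def by blast+
  let ?a = "prod_chart c d"
  let ?R = "local_rep ?a e (\<lambda>(p, q). F p q)"
  have sm: "smooth_at ?a e (\<lambda>(p, q). F p q) (p, q)" if p: "p \<in> N" for p
  proof (rule smooth_map_imp_smooth_at[OF atlas_prod_atlas[OF at(1,2)] at(3) F _ e])
    show "?a \<in> prod_atlas A B" using c d unfolding prod_atlas_eq by blast
    show "(p, q) \<in> fst ?a" using N(2) p d(2) by (auto simp: fst_prod_chart)
    show "(case (p, q) of (p, q) \<Rightarrow> F p q) \<in> fst e" using N(3)[OF p] by simp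
  qed
  have sl: "smooth_at d ?a (\<lambda>q. (p, q)) q" if p: "p \<in> N" for p
  proof (rule smooth_at_Pair)
    show "smooth_at d c (\<lambda>_. p) q"
      using p N(2) d(2) by (intro smooth_at_const chd chc) blast+
    show "smooth_at d d (\<lambda>q. q) q"
      using smooth_on_ident[OF is_chartD(2)[OF chd]] d(2)
      by (intro smooth_atI[OF chd chd is_chartD(1)[OF chd] d(2)])
        (auto intro!: smooth_on_cong[OF is_chartD(2)[OF chd], of "\<lambda>x. x"] simp: local_rep_chart chd)
  qed
  have slice: "chart_deriv d ?a (\<lambda>q. (p, q)) q (\<lambda>v. (0, v))" if p: "p \<in> N" for p
    using p N(2) by (intro chart_deriv_Pair chart_deriv_const chart_deriv_id chc chd d(2)) blast
  have image: "snd ?a (p, q) = (snd c p, snd d q)" for p by (simp add: prod_chart_def)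
  have partial: "chart_deriv d e (F p) q (\<lambda>v. frechet_derivative ?R (at (snd c p, snd d q)) (0, v))"
    if p: "p \<in> N" for p
    using chart_deriv_compose[OF slice[OF p] smooth_at_imp_chart_deriv[OF sm[OF p]]]
    by (simp add: image)
  have deriv_eq: "frechet_derivative (local_rep d e (F p)) (at (snd d q)) =
      (\<lambda>v. frechet_derivative ?R (at (snd c p, snd d q)) (0, v))" if p: "p \<in> N" for p
    using partial[OF p] frechet_derivative_at unfolding chart_deriv_def by metis
  show "chart_deriv d e (F p) q (frechet_derivative (local_rep d e (F p)) (at (snd d q)))"
    if p: "p \<in> N" for p
    using partial[OF p] unfolding deriv_eq[OF p] .
  have oN: "open (snd c ` N)" by (rule chart_open_image[OF chc N(1,2)])
  have "smooth_on (snd c ` N) (\<lambda>y. frechet_derivative ?R (at (y, snd d q)) (0, v))"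
  proof (rule smooth_on_local)
    fix y assume "y \<in> snd c ` N"
    then obtain p where p: "p \<in> N" "y = snd c p" by blast
    obtain P where P: "open P" "(p, q) \<in> P" "P \<subseteq> fst ?a" "smooth_on (snd ?a ` P) ?R"
      and cha: "is_chart ?a"
      using sm[OF p(1)] unfolding smooth_at_def by blast
    define Q where "Q = (\<lambda>y. (y, snd d q)) -` (snd ?a ` P)"
    have oQ: "open Q" unfolding Q_def
      by (intro open_vimage chart_open_image[OF cha P(1,3)] continuous_intros)
    have yQ: "y \<in> Q" using imageI[OF P(2), of "snd ?a"] unfolding Q_def p(2) image by simp
    have "smooth_on Q (\<lambda>y. frechet_derivative ?R (at (y, snd d q)) (0, v))"
      by (rule smooth_on_compose[OF oQ _ smooth_on_Pair[OF oQ smooth_on_ident[OF oQ]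
              smooth_on_const[OF oQ]] smooth_on_derivative[OF P(4)]]) (auto simp: Q_def)
    then show "\<exists>T. open T \<and> y \<in> T \<and>
        smooth_on T (\<lambda>y. frechet_derivative ?R (at (y, snd d q)) (0, v))"
      using oQ yQ by blast
  qed
  then show "smooth_on (snd c ` N)
    (\<lambda>y. frechet_derivative (local_rep d e (F (chart_inv c y))) (at (snd d q)) v)"
  proof (rule smooth_on_cong[OF oN, rotated])
    fix y assume "y \<in> snd c ` N"
    then obtain p where p: "p \<in> N" "y = snd c p" by blast
    have "chart_inv c y = p" using chart_inv_chart[OF chc] p N(2) by blast
    then show "frechet_derivative ?R (at (y, snd d q)) (0, v) =
        frechet_derivative (local_rep d e (F (chart_inv c y))) (at (snd d q)) v"
      using fun_cong[OF deriv_eq[OF p(1)], of v] p(2) by simp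
  qed
qed

subsection \<open>Maps into vector spaces\<close>

lemma smooth_map_vec_atlasI:
  assumes "atlas A" "continuous_on UNIV f" "\<And>c. c \<in> A \<Longrightarrow> smooth_on (snd c ` fst c) (f \<circ> chart_inv c)"
  shows "smooth_map A vec_atlas f"
  unfolding smooth_map_def vec_atlas_def using assms(2,3) by (simp add: case_prod_beta)

lemma smooth_map_vec_atlasD:
  assumes "smooth_map A vec_atlas f"
  shows "continuous_on UNIV f" "c \<in> A \<Longrightarrow> smooth_on (snd c ` fst c) (f \<circ> chart_inv c)"
  using assms unfolding smooth_map_def vec_atlas_def by (simp_all add: case_prod_beta)

lemma smooth_map_add:
  assumes at: "atlas A" and f: "smooth_map A vec_atlas f" and g: "smooth_map A vec_atlas g"
  shows "smooth_map A vec_atlas (\<lambda>x. f x + g x)"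
proof (rule smooth_map_vec_atlasI[OF at])
  show "continuous_on UNIV (\<lambda>x. f x + g x)"
    by (intro continuous_on_add smooth_map_vec_atlasD[OF f] smooth_map_vec_atlasD[OF g])
  fix c assume c: "c \<in> A"
  then have "open (snd c ` fst c)" using at is_chartD(2) unfolding atlas_def by blast
  from smooth_on_add[OF this smooth_map_vec_atlasD(2)[OF f c] smooth_map_vec_atlasD(2)[OF g c]]
  show "smooth_on (snd c ` fst c) ((\<lambda>x. f x + g x) \<circ> chart_inv c)" by (simp add: o_def)
qed

lemma smooth_map_bilinear:
  assumes bil: "bounded_bilinear mul" and at: "atlas A"
    and f: "smooth_map A vec_atlas f" and g: "smooth_map A vec_atlas g"
  shows "smooth_map A vec_atlas (\<lambda>x. mul (f x) (g x))"
proof (rule smooth_map_vec_atlasI[OF at])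
  show "continuous_on UNIV (\<lambda>x. mul (f x) (g x))"
    by (intro bounded_bilinear.continuous_on[OF bil] smooth_map_vec_atlasD[OF f]
        smooth_map_vec_atlasD[OF g])
  fix c assume c: "c \<in> A"
  then have "open (snd c ` fst c)" using at is_chartD(2) unfolding atlas_def by blast
  from smooth_on_bilinear[OF bil this smooth_map_vec_atlasD(2)[OF f c]
      smooth_map_vec_atlasD(2)[OF g c]]
  show "smooth_on (snd c ` fst c) ((\<lambda>x. mul (f x) (g x)) \<circ> chart_inv c)" by (simp add: o_def)
qed

lemma smooth_map_sum:
  assumes at: "atlas A" and f: "\<And>i. i \<in> I \<Longrightarrow> smooth_map A vec_atlas (f i)"
  shows "smooth_map A vec_atlas (\<lambda>x. \<Sum>i\<in>I. f i x)"
  using f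
  by (induction I rule: infinite_finite_induct)
    (simp_all add: smooth_map_const[OF at atlas_vec_atlas] smooth_map_add[OF at])

lemma chart_deriv_vec: "(f has_derivative D) (at p) \<Longrightarrow> chart_deriv vec_chart vec_chart f p D"
  using has_derivative_continuous by (auto simp: chart_deriv_def is_chart_vec local_rep_vec_chart)

lemma smooth_at_vec: "open S \<Longrightarrow> p \<in> S \<Longrightarrow> smooth_on S f \<Longrightarrow> smooth_at vec_chart vec_chart f p"
  by (intro smooth_atI[of _ _ S])
    (auto simp: is_chart_vec local_rep_vec_chart smooth_on_imp_continuous_on)

text \<open>
  The dual of a Lie algebra carries an operator norm rather than an inner product; a vector space has
  a single chart, so the projections onto it involve no change of charts.
\<close>

lemma smooth_map_vec_atlas_fst:
  assumes "atlas A"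
  shows "smooth_map (prod_atlas (vec_atlas :: ('v::real_normed_vector, 'v) chart set) A) vec_atlas fst"
proof (rule smooth_mapI[OF atlas_prod_atlas[OF atlas_vec_atlas assms] atlas_vec_atlas])
  fix e p and d :: "('v, 'v) chart"
  assume *: "e \<in> prod_atlas (vec_atlas :: ('v, 'v) chart set) A" "d \<in> vec_atlas" "p \<in> fst e"
  then obtain c where c: "e = prod_chart vec_chart c" "c \<in> A" "d = vec_chart"
    unfolding prod_atlas_eq vec_atlas_def by blast
  have "is_chart c" using assms c(2) unfolding atlas_def by blast
  moreover have "snd p \<in> fst c" using *(3) by (auto simp: c(1) fst_prod_chart)
  ultimately show "smooth_at e d fst p"
    using smooth_at_fst[OF is_chart_vec, of c "fst p" "snd p"] by (simp add: c)
qed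

lemma smooth_map_vec_atlas_snd:
  assumes "atlas A"
  shows "smooth_map (prod_atlas A (vec_atlas :: ('v::real_normed_vector, 'v) chart set)) vec_atlas snd"
proof (rule smooth_mapI[OF atlas_prod_atlas[OF assms atlas_vec_atlas] atlas_vec_atlas])
  fix e p and d :: "('v, 'v) chart"
  assume *: "e \<in> prod_atlas A (vec_atlas :: ('v, 'v) chart set)" "d \<in> vec_atlas" "p \<in> fst e"
  then obtain c where c: "e = prod_chart c vec_chart" "c \<in> A" "d = vec_chart"
    unfolding prod_atlas_eq vec_atlas_def by blast
  have "is_chart c" using assms c(2) unfolding atlas_def by blast
  moreover have "fst p \<in> fst c" using *(3) by (auto simp: c(1) fst_prod_chart)
  ultimately show "smooth_at e d snd p"
    using smooth_at_snd[OF _ is_chart_vec, of c "fst p" "snd p"] by (simp add: c)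
qed

lemma chart_deriv_diff:
  assumes f: "chart_deriv c vec_chart f p D" and g: "chart_deriv c vec_chart g p E"
  shows "chart_deriv c vec_chart (\<lambda>x. f x - g x) p (\<lambda>v. D v - E v)"
proof -
  have "local_rep c vec_chart (\<lambda>x. f x - g x) =
      (\<lambda>y. local_rep c vec_chart f y - local_rep c vec_chart g y)"
    by (simp add: local_rep_def fun_eq_iff)
  moreover have "((\<lambda>y. local_rep c vec_chart f y - local_rep c vec_chart g y) has_derivative
      (\<lambda>v. D v - E v)) (at (snd c p))"
    using f g by (intro has_derivative_diff) (simp_all add: chart_deriv_def)
  moreover have "isCont (\<lambda>x. f x - g x) p"
    using f g by (intro continuous_diff) (simp_all add: chart_deriv_def)
  ultimately show ?thesis using f by (simp add: chart_deriv_def)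
qed

section \<open>One-parameter subgroups\<close>

context lie_group
begin

lemma in_carrier [simp]: "x \<in> carrier G"
  by (simp add: carrier_UNIV)

lemma cancel_left [simp]: "x \<otimes> (inv x \<otimes> y) = y" "inv x \<otimes> (x \<otimes> y) = y"
  by (simp_all add: m_assoc[symmetric])

lemma smooth_map_mult:
  assumes "atlas P" "smooth_map P A f" "smooth_map P A g"
  shows "smooth_map P A (\<lambda>x. f x \<otimes> g x)"
  using smooth_map_compose[OF assms(1) atlas_prod_atlas[OF atlas atlas] atlas
      smooth_map_Pair[OF assms(1) atlas atlas assms(2,3)] smooth_mult] by simp

lemma smooth_map_inv:
  assumes "atlas P" "smooth_map P A f"
  shows "smooth_map P A (\<lambda>x. inv (f x))"
  by (rule smooth_map_compose[OF assms(1) atlas atlas assms(2) smooth_inv])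

lemma smooth_map_translation: "smooth_map A A (\<lambda>x. g \<otimes> x \<otimes> h)"
  by (intro smooth_map_mult atlas smooth_map_const smooth_map_id)

lemma smooth_map_left_translation: "smooth_map A A (\<lambda>x. g \<otimes> x)"
  by (intro smooth_map_mult atlas smooth_map_const smooth_map_id)

abbreviation unit_chart where "unit_chart \<equiv> chart_at A \<one>"

lemma unit_chart: "unit_chart \<in> A" "\<one> \<in> fst unit_chart"
  using chart_at_in[OF atlas] by blast+

text \<open>The curve \<open>\<gamma>\<close> solves \<open>\<gamma>' = T L\<^sub>\<gamma> X\<close> at time \<open>t\<close>.\<close>

definition left_velocity :: "(real \<Rightarrow> 'g) \<Rightarrow> 'e \<Rightarrow> real \<Rightarrow> bool" where
  "left_velocity \<gamma> X t \<longleftrightarrow>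
     chart_deriv vec_chart unit_chart (\<lambda>s. inv (\<gamma> t) \<otimes> \<gamma> (t + s)) 0 (\<lambda>s. s *\<^sub>R X)"

text \<open>
  Up to a left and a right translation, the quotient of two curves is near \<open>t\<close> the quotient of
  two curves through the unit with the same velocity. The map \<open>(x, y) \<mapsto> x y\<^sup>-\<^sup>1\<close> is constant on
  the diagonal, so its derivative at the unit vanishes on pairs of equal vectors.
\<close>

lemma chart_deriv_quotient:
  assumes a: "left_velocity a X t" and b: "left_velocity b X t"
  shows "chart_deriv vec_chart (chart_at A (a t \<otimes> inv (b t))) (\<lambda>s. a s \<otimes> inv (b s)) t (\<lambda>_. 0)"
proof -
  let ?\<alpha> = "\<lambda>s. inv (a t) \<otimes> a (t + s)" and ?\<beta> = "\<lambda>s. inv (b t) \<otimes> b (t + s)"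
  let ?e = unit_chart
  let ?q = "\<lambda>p. fst p \<otimes> inv (snd p)"
  have e: "is_chart ?e" using unit_chart charts by blast
  have sm: "smooth_map (prod_atlas A A) A ?q"
    by (intro smooth_map_mult smooth_map_inv smooth_map_fst smooth_map_snd atlas atlas_prod_atlas)
      unfold_locales
  have "smooth_at (prod_chart ?e ?e) ?e ?q (\<one>, \<one>)"
    using unit_chart
    by (intro smooth_map_imp_smooth_at[OF atlas_prod_atlas[OF atlas atlas] atlas sm])
      (auto simp: prod_chart_in_prod_atlas fst_prod_chart)
  then obtain Q where Q: "chart_deriv (prod_chart ?e ?e) ?e ?q (\<one>, \<one>) Q"
    using smooth_at_imp_chart_deriv by blast
  have pair: "chart_deriv vec_chart ?e (\<lambda>s. u s \<otimes> inv (v s)) 0 (\<lambda>s. Q (s *\<^sub>R X, s *\<^sub>R X))"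
    if u: "chart_deriv vec_chart ?e u 0 (\<lambda>s. s *\<^sub>R X)" "u 0 = \<one>"
      and v: "chart_deriv vec_chart ?e v 0 (\<lambda>s. s *\<^sub>R X)" "v 0 = \<one>" for u v
    using chart_deriv_compose[OF chart_deriv_Pair[OF u(1) v(1)], of ?e ?q Q] Q u(2) v(2) by simp
  have "chart_deriv vec_chart ?e (\<lambda>_. \<one>) 0 (\<lambda>s. Q (s *\<^sub>R X, s *\<^sub>R X))"
    using pair[of ?\<alpha> ?\<alpha>] a by (simp add: left_velocity_def)
  from chart_deriv_unique[OF this chart_deriv_const[OF is_chart_vec e]]
  have Q0: "(\<lambda>s. Q (s *\<^sub>R X, s *\<^sub>R X)) = (\<lambda>_. 0)" using unit_chart by simp
  have 1: "chart_deriv vec_chart ?e (\<lambda>s. ?\<alpha> s \<otimes> inv (?\<beta> s)) 0 (\<lambda>_. 0)"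
    using pair[of ?\<alpha> ?\<beta>] a b unfolding Q0 by (simp add: left_velocity_def)
  have shift: "chart_deriv vec_chart vec_chart (\<lambda>s. s - t) t (\<lambda>h. h)"
    by (intro chart_deriv_vec) (auto intro!: derivative_eq_intros)
  have 2: "chart_deriv vec_chart ?e (\<lambda>s. ?\<alpha> (s - t) \<otimes> inv (?\<beta> (s - t))) t (\<lambda>_. 0)"
    using chart_deriv_compose[OF shift, of ?e "\<lambda>s. ?\<alpha> s \<otimes> inv (?\<beta> s)"] 1 by simp
  let ?T = "\<lambda>x. a t \<otimes> x \<otimes> inv (b t)"
  obtain T where T: "chart_deriv ?e (chart_at A (?T \<one>)) ?T \<one> T"
    using chart_deriv_tangent_map[OF atlas atlas smooth_map_translation] by blast
  have "?T (?\<alpha> (s - t) \<otimes> inv (?\<beta> (s - t))) = a s \<otimes> inv (b s)" for s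
    by (simp add: inv_mult_group m_assoc)
  moreover have "?\<alpha> (t - t) \<otimes> inv (?\<beta> (t - t)) = \<one>" by simp
  ultimately show ?thesis
    using chart_deriv_compose[OF 2, of "chart_at A (?T \<one>)" ?T T] T
      linear_0[OF chart_deriv_linear[OF T]] by simp
qed

text \<open>
  This takes the place of uniqueness of integral curves: with \<open>a\<close> and \<open>b\<close> equal at one time
  it yields equality on the whole interval.
\<close>

lemma left_velocity_imp_quotient_constant:
  assumes "open S" "connected S" "s \<in> S" "t \<in> S"
    and "\<And>t. t \<in> S \<Longrightarrow> left_velocity a X t" "\<And>t. t \<in> S \<Longrightarrow> left_velocity b X t"
  shows "a s \<otimes> inv (b s) = a t \<otimes> inv (b t)"
proof (rule zero_derivative_imp_constant[where f = "\<lambda>s. a s \<otimes> inv (b s)",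
      OF smooth_manifold_vec_atlas smooth_manifold_axioms assms(1,2) _ assms(3,4)])
  fix p assume "p \<in> S"
  from chart_deriv_quotient[OF assms(5,6), OF this this]
  show "\<exists>c\<in>vec_atlas. \<exists>d\<in>A. chart_deriv c d (\<lambda>s. a s \<otimes> inv (b s)) p (\<lambda>_. 0)"
    using chart_at_in[OF atlas] by (auto simp: vec_atlas_def)
qed

lemma left_velocity_left_translation:
  "left_velocity \<gamma> X t \<Longrightarrow> left_velocity (\<lambda>t. g \<otimes> \<gamma> t) X t"
  by (simp add: left_velocity_def inv_mult_group m_assoc)

lemma left_velocity_shift:
  "left_velocity \<gamma> X (r + t) \<Longrightarrow> left_velocity (\<lambda>t. \<gamma> (r + t)) X t"
  by (simp add: left_velocity_def add.assoc)

lemma eq_of_quotient: "x \<otimes> inv y = \<one> \<Longrightarrow> x = y"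
  by (metis in_carrier inv_equality inv_inv inv_closed)

text \<open>
  The equation \<open>\<gamma>' = T L\<^sub>\<gamma> X\<close> in the chart around the unit is \<open>y' = V y\<close>, where \<open>V y\<close> is the partial
  derivative of the multiplication in the second variable, at the unit and in direction \<open>X\<close>.
\<close>

lemma local_integral_curve:
  obtains \<epsilon> \<gamma> where "0 < \<epsilon>" "\<gamma> 0 = \<one>" "\<And>t. t \<in> {-\<epsilon><..<\<epsilon>} \<Longrightarrow> left_velocity \<gamma> X t"
    "\<And>t. t \<in> {-\<epsilon><..<\<epsilon>} \<Longrightarrow> smooth_at vec_chart unit_chart \<gamma> t"
proof -
  let ?c = unit_chart
  have c: "is_chart ?c" using unit_chart charts by blast
  define V where
    "V = (\<lambda>y. frechet_derivative (local_rep ?c ?c (\<lambda>q. chart_inv ?c y \<otimes> q)) (at (snd ?c \<one>)) X)"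
  note partial = smooth_partial_derivative[OF atlas atlas atlas smooth_mult unit_chart(1,1,2,1)
      is_chartD(1)[OF c] subset_refl]
  have V: "smooth_on (snd ?c ` fst ?c) V" unfolding V_def by (rule partial(1)) simp
  obtain \<epsilon> y where y: "0 < \<epsilon>" "y 0 = snd ?c \<one>" "\<And>t. t \<in> {-\<epsilon><..<\<epsilon>} \<Longrightarrow> y t \<in> snd ?c ` fst ?c"
    "\<And>t. t \<in> {-\<epsilon><..<\<epsilon>} \<Longrightarrow> (y has_vector_derivative V (y t)) (at t)"
    "smooth_on {-\<epsilon><..<\<epsilon>} y"
    using smooth_ode_local_solution[OF is_chartD(2)[OF c] imageI[OF unit_chart(2)] V] by blast
  define \<gamma> where "\<gamma> = (\<lambda>t. chart_inv ?c (y t))"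
  have \<gamma>: "\<gamma> t \<in> fst ?c" "snd ?c (\<gamma> t) = y t" if "t \<in> {-\<epsilon><..<\<epsilon>}" for t
    unfolding \<gamma>_def by (rule chart_inv_in[OF y(3)[OF that]], rule chart_chart_inv[OF y(3)[OF that]])
  have sm: "smooth_at vec_chart ?c \<gamma> t" if t: "t \<in> {-\<epsilon><..<\<epsilon>}" for t
  proof (rule smooth_atI[OF is_chart_vec c open_greaterThanLessThan t])
    show "continuous_on {-\<epsilon><..<\<epsilon>} \<gamma>" unfolding \<gamma>_def
      by (rule continuous_on_compose2[OF chart_inv_continuous_on[OF c]
            smooth_on_imp_continuous_on[OF y(5)]]) (use y(3) in blast)
    have "smooth_on {-\<epsilon><..<\<epsilon>} (snd ?c \<circ> \<gamma>)"
      by (rule smooth_on_cong[OF _ _ y(5)]) (simp_all add: \<gamma>(2))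
    then show "smooth_on (snd vec_chart ` {-\<epsilon><..<\<epsilon>}) (local_rep vec_chart ?c \<gamma>)"
      by (simp add: local_rep_vec_chart)
    show "\<gamma> ` {-\<epsilon><..<\<epsilon>} \<subseteq> fst ?c" using \<gamma>(1) by blast
  qed simp
  have vel: "left_velocity \<gamma> X t" if t: "t \<in> {-\<epsilon><..<\<epsilon>}" for t
  proof -
    have "(snd ?c \<circ> \<gamma> has_vector_derivative V (y t)) (at t)"
      by (rule has_vector_derivative_transform_within_open[OF y(4)[OF t] open_greaterThanLessThan t])
        (simp add: \<gamma>(2))
    then have D\<gamma>: "chart_deriv vec_chart ?c \<gamma> t (\<lambda>s. s *\<^sub>R V (y t))"
      using smooth_at_imp_chart_deriv[OF sm[OF t]]
      by (simp add: chart_deriv_def local_rep_vec_chart has_vector_derivative_def)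
    define D where "D = frechet_derivative (local_rep ?c ?c (\<lambda>q. \<gamma> t \<otimes> q)) (at (snd ?c \<one>))"
    have D: "chart_deriv ?c ?c (\<lambda>q. \<gamma> t \<otimes> q) \<one> D"
      unfolding D_def by (rule partial(2)) (use \<gamma>(1)[OF t] in simp_all)
    \<comment> \<open>Translating back by \<open>\<gamma>(t)\<^sup>-\<^sup>1\<close> inverts \<open>D\<close> and so turns the velocity \<open>V (y t) = D X\<close> into \<open>X\<close>.\<close>
    have "smooth_at ?c ?c (\<lambda>q. inv (\<gamma> t) \<otimes> q) (\<gamma> t)"
      using unit_chart \<gamma>(1)[OF t]
      by (intro smooth_map_imp_smooth_at[OF atlas atlas smooth_map_left_translation]) auto
    then obtain E where E: "chart_deriv ?c ?c (\<lambda>q. inv (\<gamma> t) \<otimes> q) (\<gamma> t) E"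
      using smooth_at_imp_chart_deriv by blast
    have "chart_deriv ?c ?c (\<lambda>q. q) \<one> (\<lambda>v. E (D v))"
      using chart_deriv_compose[OF D, of ?c "\<lambda>q. inv (\<gamma> t) \<otimes> q" E] E by simp
    then have "(\<lambda>v. E (D v)) = (\<lambda>v. v)"
      using chart_deriv_id[OF c unit_chart(2)] by (rule chart_deriv_unique)
    moreover have "V (y t) = D X" by (simp add: V_def D_def \<gamma>_def)
    ultimately have EV: "E (V (y t)) = X" by (metis (no_types))
    have shift: "chart_deriv vec_chart vec_chart (\<lambda>s. t + s) 0 (\<lambda>h. h)"
      by (intro chart_deriv_vec) (auto intro!: derivative_eq_intros)
    have "chart_deriv vec_chart ?c (\<lambda>s. \<gamma> (t + s)) 0 (\<lambda>s. s *\<^sub>R V (y t))"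
      using chart_deriv_compose[OF shift, of ?c \<gamma>] D\<gamma> by simp
    from chart_deriv_compose[OF this, of ?c "\<lambda>q. inv (\<gamma> t) \<otimes> q" E] E
    show ?thesis
      by (simp add: left_velocity_def linear_scale[OF chart_deriv_linear[OF E]] EV)
  qed
  have "\<gamma> 0 = \<one>" by (simp add: \<gamma>_def y(2) chart_inv_chart[OF c unit_chart(2)])
  then show thesis using that[OF y(1) _ vel sm] by blast
qed

end

context lie_group
begin

lemma local_one_parameter_subgroup:
  obtains \<epsilon> \<gamma> where "0 < \<epsilon>" "left_velocity \<gamma> X 0" "smooth_at vec_chart unit_chart \<gamma> 0"
    "\<And>s t. \<bar>s\<bar> < \<epsilon> \<Longrightarrow> \<bar>t\<bar> < \<epsilon> \<Longrightarrow> \<bar>s + t\<bar> < \<epsilon> \<Longrightarrow> \<gamma> (s + t) = \<gamma> s \<otimes> \<gamma> t"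
proof -
  obtain \<epsilon> \<gamma> where \<gamma>: "0 < \<epsilon>" "\<gamma> 0 = \<one>" "\<And>t. t \<in> {-\<epsilon><..<\<epsilon>} \<Longrightarrow> left_velocity \<gamma> X t"
    "\<And>t. t \<in> {-\<epsilon><..<\<epsilon>} \<Longrightarrow> smooth_at vec_chart unit_chart \<gamma> t"
    using local_integral_curve by blast
  have "\<gamma> (s + t) = \<gamma> s \<otimes> \<gamma> t" if "\<bar>s\<bar> < \<epsilon>" "\<bar>t\<bar> < \<epsilon>" "\<bar>s + t\<bar> < \<epsilon>" for s t
  proof -
    \<comment> \<open>As functions of \<open>t\<close>, both sides satisfy \<open>\<delta>' = T L\<^sub>\<delta> X\<close> on the interval \<open>?S\<close>.\<close>
    let ?S = "{-\<epsilon><..<\<epsilon>} \<inter> {-\<epsilon> - s<..<\<epsilon> - s}"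
    have S: "open ?S" "connected ?S"
      by (auto intro!: convex_connected convex_Int)
    have "\<gamma> s \<otimes> \<gamma> t \<otimes> inv (\<gamma> (s + t)) = \<gamma> s \<otimes> \<gamma> 0 \<otimes> inv (\<gamma> (s + 0))"
    proof (rule left_velocity_imp_quotient_constant[OF S, of t 0 "\<lambda>t. \<gamma> s \<otimes> \<gamma> t" X "\<lambda>t. \<gamma> (s + t)"])
      show "t \<in> ?S" "0 \<in> ?S" using that \<gamma>(1) by auto
      fix r assume "r \<in> ?S"
      then have r: "r \<in> {-\<epsilon><..<\<epsilon>}" "s + r \<in> {-\<epsilon><..<\<epsilon>}" by auto
      show "left_velocity (\<lambda>t. \<gamma> s \<otimes> \<gamma> t) X r" by (rule left_velocity_left_translation[OF \<gamma>(3)[OF r(1)]])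
      show "left_velocity (\<lambda>t. \<gamma> (s + t)) X r" by (rule left_velocity_shift[OF \<gamma>(3)[OF r(2)]])
    qed
    then have "\<gamma> s \<otimes> \<gamma> t \<otimes> inv (\<gamma> (s + t)) = \<one>" by (simp add: \<gamma>(2))
    then show ?thesis using eq_of_quotient by metis
  qed
  then show thesis using that[of \<epsilon> \<gamma>] \<gamma> by simp
qed

text \<open>
  A local one-parameter subgroup extends to the real line by \<open>t \<mapsto> \<gamma>(t/n)\<^sup>n\<close> for any \<open>n\<close> large
  enough; two choices of \<open>n\<close> agree because \<open>\<gamma>(t/n) = \<gamma>(t/(n m))\<^sup>m\<close>.
\<close>

lemma extend_local_hom:
  fixes \<gamma> :: "real \<Rightarrow> 'g"
  assumes "0 < \<epsilon>"
    and hom: "\<And>s t. \<bar>s\<bar> < \<epsilon> \<Longrightarrow> \<bar>t\<bar> < \<epsilon> \<Longrightarrow> \<bar>s + t\<bar> < \<epsilon> \<Longrightarrow> \<gamma> (s + t) = \<gamma> s \<otimes> \<gamma> t"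
  obtains \<Gamma> where "\<And>s t. \<Gamma> (s + t) = \<Gamma> s \<otimes> \<Gamma> t" "\<And>t. \<bar>t\<bar> < \<epsilon> \<Longrightarrow> \<Gamma> t = \<gamma> t"
proof -
  have "\<gamma> 0 \<otimes> \<gamma> 0 = \<gamma> 0" using hom[of 0 0] \<open>0 < \<epsilon>\<close> by simp
  then have \<gamma>0: "\<gamma> 0 = \<one>" using l_cancel_one by simp
  have mult: "\<gamma> (real n * v) = \<gamma> v [^] n" if "real n * \<bar>v\<bar> < \<epsilon>" for n v
    using that
  proof (induction n)
    case (Suc n)
    have 1: "real n * \<bar>v\<bar> < \<epsilon>" "\<bar>v\<bar> < \<epsilon>"
    proof -
      have "real n * \<bar>v\<bar> + \<bar>v\<bar> < \<epsilon>" using Suc.prems by (simp add: algebra_simps)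
      moreover have "0 \<le> real n * \<bar>v\<bar>" by simp
      ultimately show "real n * \<bar>v\<bar> < \<epsilon>" "\<bar>v\<bar> < \<epsilon>" by linarith+
    qed
    have sum: "real (Suc n) * v = real n * v + v" by (simp add: algebra_simps)
    have "\<bar>real n * v + v\<bar> < \<epsilon>" using Suc.prems unfolding sum[symmetric] by (simp add: abs_mult)
    then have "\<gamma> (real n * v + v) = \<gamma> (real n * v) \<otimes> \<gamma> v"
      using 1 by (intro hom) (simp_all add: abs_mult)
    then show ?case using Suc.IH[OF 1(1)] unfolding sum by simp
  qed (simp add: \<gamma>0)
  define N where "N = (\<lambda>t. Suc (nat \<lceil>\<bar>t\<bar> / \<epsilon>\<rceil>))"
  define \<Gamma> where "\<Gamma> = (\<lambda>t. \<gamma> (t / real (N t)) [^] N t)"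
  have N: "\<bar>t\<bar> / real (N t) < \<epsilon>" "0 < N t" for t
  proof -
    show "0 < N t" by (simp add: N_def)
    moreover have "\<bar>t\<bar> / \<epsilon> < real (N t)" unfolding N_def by linarith
    ultimately show "\<bar>t\<bar> / real (N t) < \<epsilon>"
      using \<open>0 < \<epsilon>\<close> by (simp add: field_simps)
  qed
  have refine: "\<gamma> (t / real n) [^] n = \<gamma> (t / real (n * m)) [^] (n * m)"
    if "\<bar>t\<bar> / real n < \<epsilon>" "0 < n" "0 < m" for t n m
  proof -
    have "\<gamma> (t / real n) = \<gamma> (real m * (t / real (n * m)))" using that by simp
    also have "\<dots> = \<gamma> (t / real (n * m)) [^] m"
      using that by (intro mult) (simp add: abs_mult field_simps)
    finally show ?thesis by (simp add: nat_pow_pow mult.commute)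
  qed
  have \<Gamma>: "\<Gamma> t = \<gamma> (t / real n) [^] n" if "\<bar>t\<bar> / real n < \<epsilon>" "0 < n" for t n
    using refine[OF N, of n t] refine[OF that N(2), of t] that by (simp add: \<Gamma>_def mult.commute)
  show thesis
  proof (rule that)
    show "\<Gamma> t = \<gamma> t" if "\<bar>t\<bar> < \<epsilon>" for t using \<Gamma>[of t 1] that by simp
    show "\<Gamma> (s + t) = \<Gamma> s \<otimes> \<Gamma> t" for s t
    proof -
      let ?n = "N (\<bar>s\<bar> + \<bar>t\<bar>)"
      have n: "0 < ?n" "(\<bar>s\<bar> + \<bar>t\<bar>) / real ?n < \<epsilon>" using N[of "\<bar>s\<bar> + \<bar>t\<bar>"] by simp_all
      have le: "\<bar>r\<bar> / real ?n < \<epsilon>" if "\<bar>r\<bar> \<le> \<bar>s\<bar> + \<bar>t\<bar>" for r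
        using divide_right_mono[OF that, of "real ?n"] n(2) by simp
      have b: "\<bar>s\<bar> / real ?n < \<epsilon>" "\<bar>t\<bar> / real ?n < \<epsilon>" "\<bar>s + t\<bar> / real ?n < \<epsilon>"
        by (intro le; simp)+
      have st: "\<gamma> (s / real ?n + t / real ?n) = \<gamma> (s / real ?n) \<otimes> \<gamma> (t / real ?n)"
        using b by (intro hom) (simp_all flip: add_divide_distrib)
      have "\<gamma> (t / real ?n + s / real ?n) = \<gamma> (t / real ?n) \<otimes> \<gamma> (s / real ?n)"
        using b by (intro hom) (simp_all flip: add_divide_distrib add: add.commute)
      then have "\<gamma> (s / real ?n) \<otimes> \<gamma> (t / real ?n) = \<gamma> (t / real ?n) \<otimes> \<gamma> (s / real ?n)"
        using st by (simp add: add.commute)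
      then have "(\<gamma> (s / real ?n) \<otimes> \<gamma> (t / real ?n)) [^] ?n =
          \<gamma> (s / real ?n) [^] ?n \<otimes> \<gamma> (t / real ?n) [^] ?n"
        by (intro pow_mult_distrib) simp_all
      then show ?thesis
        using \<Gamma>[OF b(1) n(1)] \<Gamma>[OF b(2) n(1)] \<Gamma>[OF b(3) n(1)] st by (simp add: add_divide_distrib)
    qed
  qed
qed

lemma hom_zero: "(\<And>s t. \<gamma> (s + t) = \<gamma> s \<otimes> \<gamma> t) \<Longrightarrow> \<gamma> (0::real) = \<one>"
  using l_cancel_one[of "\<gamma> 0" "\<gamma> 0"] by (metis add_0 in_carrier)

lemma one_parameter_subgroup_exists: "\<exists>\<gamma>. one_parameter_subgroup G A X \<gamma>"
proof -
  obtain \<epsilon> \<gamma> where \<gamma>: "0 < \<epsilon>" "left_velocity \<gamma> X 0" "smooth_at vec_chart unit_chart \<gamma> 0"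
    "\<And>s t. \<bar>s\<bar> < \<epsilon> \<Longrightarrow> \<bar>t\<bar> < \<epsilon> \<Longrightarrow> \<bar>s + t\<bar> < \<epsilon> \<Longrightarrow> \<gamma> (s + t) = \<gamma> s \<otimes> \<gamma> t"
    using local_one_parameter_subgroup by blast
  obtain \<Gamma> where hom: "\<And>s t. \<Gamma> (s + t) = \<Gamma> s \<otimes> \<Gamma> t" and \<Gamma>\<gamma>: "\<And>t. \<bar>t\<bar> < \<epsilon> \<Longrightarrow> \<Gamma> t = \<gamma> t"
    using extend_local_hom[OF \<gamma>(1,4)] by blast
  have \<Gamma>0: "\<Gamma> 0 = \<one>" by (rule hom_zero[of \<Gamma>, OF hom])
  then have \<gamma>0: "\<gamma> 0 = \<one>" using \<Gamma>\<gamma>[of 0] \<gamma>(1) by simp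
  have eq: "\<gamma> x = \<Gamma> x" if "x \<in> {-\<epsilon><..<\<epsilon>}" for x using \<Gamma>\<gamma>[of x] that by auto
  have I: "open {-\<epsilon><..<\<epsilon>}" "0 \<in> {-\<epsilon><..<\<epsilon>}" using \<gamma>(1) by auto
  have "smooth_map vec_atlas A \<Gamma>"
  proof (rule smooth_mapI[OF atlas_vec_atlas atlas])
    fix c :: "(real, real) chart" and d and p :: real
    assume c: "c \<in> vec_atlas" and d: "d \<in> A" "\<Gamma> p \<in> fst d"
    \<comment> \<open>Near \<open>p\<close> the curve is \<open>\<Gamma> p\<close> times a curve that is known to be smooth near \<open>0\<close>.\<close>
    have shift: "smooth_at vec_chart vec_chart (\<lambda>t. - p + t) p"
      by (rule smooth_at_vec[OF open_UNIV UNIV_I])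
        (intro smooth_on_add smooth_on_const smooth_on_ident open_UNIV)
    have 0: "smooth_at vec_chart unit_chart \<Gamma> (- p + p)"
      using smooth_at_cong[OF \<gamma>(3) I eq] by simp
    have L: "smooth_at unit_chart d (\<lambda>x. \<Gamma> p \<otimes> x) (\<Gamma> (- p + p))"
      using unit_chart d \<Gamma>0
      by (intro smooth_map_imp_smooth_at[OF atlas atlas smooth_map_left_translation]) auto
    have "\<Gamma> p \<otimes> \<Gamma> (- p + t) = \<Gamma> t" for t using hom[of p "- p + t"] by simp
    then show "smooth_at c d \<Gamma> p"
      using smooth_at_compose[OF smooth_at_compose[OF shift 0] L] c by (simp add: vec_atlas_def)
  qed
  moreover have "velocity A \<Gamma> 0 = X"
  proof (rule velocity_eqI)
    have "chart_deriv vec_chart unit_chart \<gamma> 0 (\<lambda>h. h *\<^sub>R X)"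
      using \<gamma>(2) by (simp add: left_velocity_def \<gamma>0)
    from chart_deriv_cong[OF this I eq]
    show "chart_deriv vec_chart (chart_at A (\<Gamma> 0)) \<Gamma> 0 (\<lambda>h. h *\<^sub>R X)" by (simp add: \<Gamma>0)
  qed
  ultimately show ?thesis unfolding one_parameter_subgroup_def using hom by blast
qed

lemma one_parameter_subgroupD:
  assumes "one_parameter_subgroup G A X \<gamma>"
  shows "smooth_map vec_atlas A \<gamma>" "\<gamma> (s + t) = \<gamma> s \<otimes> \<gamma> t" "\<gamma> 0 = \<one>" "velocity A \<gamma> 0 = X"
  using assms hom_zero[of \<gamma>] unfolding one_parameter_subgroup_def by auto

lemma one_parameter_subgroup_chart_deriv:
  assumes "one_parameter_subgroup G A X \<gamma>"
  shows "chart_deriv vec_chart unit_chart \<gamma> 0 (\<lambda>h. h *\<^sub>R X)"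
  using chart_deriv_velocity[OF atlas, of \<gamma> 0] one_parameter_subgroupD[OF assms] by simp

lemma one_parameter_subgroup_unique:
  assumes a: "one_parameter_subgroup G A X a" and b: "one_parameter_subgroup G A X b"
  shows "a = b"
proof
  fix t
  have vel: "left_velocity \<gamma> X t" if \<gamma>: "one_parameter_subgroup G A X \<gamma>" for \<gamma> t
    using one_parameter_subgroup_chart_deriv[OF \<gamma>] one_parameter_subgroupD(2)[OF \<gamma>]
    by (simp add: left_velocity_def)
  have "a t \<otimes> inv (b t) = a 0 \<otimes> inv (b 0)"
    by (rule left_velocity_imp_quotient_constant[OF open_UNIV connected_UNIV UNIV_I UNIV_I
          vel[OF a] vel[OF b]])
  then have "a t \<otimes> inv (b t) = \<one>"
    using one_parameter_subgroupD(3)[OF a] one_parameter_subgroupD(3)[OF b] by simp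
  then show "a t = b t" by (rule eq_of_quotient)
qed

lemma lie_exp_eq:
  assumes "one_parameter_subgroup G A X \<gamma>"
  shows "lie_exp G A X = \<gamma> 1"
proof -
  have "(THE \<gamma>. one_parameter_subgroup G A X \<gamma>) = \<gamma>"
    by (rule the_equality, rule assms, rule one_parameter_subgroup_unique[OF _ assms])
  then show ?thesis by (simp add: lie_exp_def)
qed

text \<open>
  The curve \<open>t \<mapsto> \<gamma> (s t)\<close> is a one-parameter subgroup with initial velocity \<open>s X\<close>.
\<close>

lemma lie_exp_scale:
  assumes \<gamma>: "one_parameter_subgroup G A X \<gamma>"
  shows "lie_exp G A (s *\<^sub>R X) = \<gamma> s"
proof -
  note D = one_parameter_subgroupD[OF \<gamma>]
  have scale: "bounded_linear (\<lambda>t::real. s * t)" by (rule bounded_linear_mult_right)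
  have "smooth_map vec_atlas vec_atlas (\<lambda>t. s * t)"
    using bounded_linear.continuous_on[OF scale continuous_on_id] smooth_on_bounded_linear[OF scale open_UNIV]
    by (intro smooth_map_vec_atlasI atlas_vec_atlas) (auto simp: vec_atlas_def inv_id)
  then have "smooth_map vec_atlas A (\<lambda>t. \<gamma> (s * t))"
    by (rule smooth_map_compose[OF atlas_vec_atlas atlas_vec_atlas atlas _ D(1)])
  moreover have "\<gamma> (s * (t + u)) = \<gamma> (s * t) \<otimes> \<gamma> (s * u)" for t u
    by (simp add: distrib_left D(2))
  moreover have "velocity A (\<lambda>t. \<gamma> (s * t)) 0 = s *\<^sub>R X"
  proof (rule velocity_eqI)
    have "chart_deriv vec_chart vec_chart (\<lambda>t. s * t) 0 (\<lambda>t. s * t)"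
      by (intro chart_deriv_vec bounded_linear_imp_has_derivative scale)
    from chart_deriv_compose[OF this, of unit_chart \<gamma>] one_parameter_subgroup_chart_deriv[OF \<gamma>]
    show "chart_deriv vec_chart (chart_at A (\<gamma> (s * 0))) (\<lambda>t. \<gamma> (s * t)) 0 (\<lambda>h. h *\<^sub>R s *\<^sub>R X)"
      by (simp add: D(3) mult.commute)
  qed
  ultimately have "one_parameter_subgroup G A (s *\<^sub>R X) (\<lambda>t. \<gamma> (s * t))"
    unfolding one_parameter_subgroup_def by blast
  from lie_exp_eq[OF this] show ?thesis by simp
qed

section \<open>The adjoint and coadjoint representations\<close>

lemma chart_deriv_Ad:
  "chart_deriv unit_chart unit_chart (\<lambda>h. g \<otimes> h \<otimes> inv g) \<one> (Ad G A g)"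
  using chart_deriv_tangent_map[OF atlas atlas smooth_map_translation[of g "inv g"], of \<one>]
  by (simp add: Ad_def)

lemma Ad_mult: "Ad G A (g \<otimes> h) X = Ad G A g (Ad G A h X)"
proof -
  have "g \<otimes> (h \<otimes> x \<otimes> inv h) \<otimes> inv g = (g \<otimes> h) \<otimes> x \<otimes> inv (g \<otimes> h)" for x
    by (simp add: inv_mult_group m_assoc)
  then have "chart_deriv unit_chart unit_chart (\<lambda>x. (g \<otimes> h) \<otimes> x \<otimes> inv (g \<otimes> h)) \<one>
      (\<lambda>X. Ad G A g (Ad G A h X))"
    using chart_deriv_compose[OF chart_deriv_Ad[of h], of unit_chart "\<lambda>x. g \<otimes> x \<otimes> inv g" "Ad G A g"]
      chart_deriv_Ad[of g] by simp
  from chart_deriv_unique[OF chart_deriv_Ad this] show ?thesis by simp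
qed

lemma Ad_one: "Ad G A \<one> X = X"
  using chart_deriv_unique[OF chart_deriv_Ad[of \<one>]] chart_deriv_id[OF charts unit_chart(2)]
    unit_chart(1) by simp

lemma bounded_linear_Ad: "bounded_linear (Ad G A g)"
  using chart_deriv_Ad[of g] has_derivative_bounded_linear unfolding chart_deriv_def by blast

lemma Ad_star_apply: "blinfun_apply (Ad_star G A g \<xi>) X = blinfun_apply \<xi> (Ad G A g X)"
proof -
  have "bounded_linear (\<lambda>X. blinfun_apply \<xi> (Ad G A g X))"
    by (rule bounded_linear_compose[OF blinfun.bounded_linear_right bounded_linear_Ad])
  then show ?thesis by (simp add: Ad_star_def bounded_linear_Blinfun_apply)
qed

text \<open>
  Conjugation by \<open>g\<close> is a homomorphism with derivative \<open>Ad\<^sub>g\<close> at the unit, so it maps the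
  one-parameter subgroup of \<open>X\<close> to that of \<open>Ad\<^sub>g X\<close>.
\<close>

lemma lie_exp_Ad:
  "lie_exp G A (s *\<^sub>R Ad G A g X) = g \<otimes> lie_exp G A (s *\<^sub>R X) \<otimes> inv g"
proof -
  obtain \<gamma> where \<gamma>: "one_parameter_subgroup G A X \<gamma>" using one_parameter_subgroup_exists by blast
  note D = one_parameter_subgroupD[OF \<gamma>]
  have "velocity A (\<lambda>t. g \<otimes> \<gamma> t \<otimes> inv g) 0 = Ad G A g X"
  proof (rule velocity_eqI)
    show "chart_deriv vec_chart (chart_at A (g \<otimes> \<gamma> 0 \<otimes> inv g)) (\<lambda>t. g \<otimes> \<gamma> t \<otimes> inv g) 0
        (\<lambda>h. h *\<^sub>R Ad G A g X)"
      using chart_deriv_compose[OF one_parameter_subgroup_chart_deriv[OF \<gamma>],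
          of unit_chart "\<lambda>x. g \<otimes> x \<otimes> inv g" "Ad G A g"] chart_deriv_Ad[of g]
      by (simp add: D(3) linear_scale[OF chart_deriv_linear[OF chart_deriv_Ad]])
  qed
  moreover have "smooth_map vec_atlas A (\<lambda>t. g \<otimes> \<gamma> t \<otimes> inv g)"
    by (rule smooth_map_compose[OF atlas_vec_atlas atlas atlas D(1) smooth_map_translation])
  moreover have "g \<otimes> \<gamma> (s + t) \<otimes> inv g = (g \<otimes> \<gamma> s \<otimes> inv g) \<otimes> (g \<otimes> \<gamma> t \<otimes> inv g)" for s t
    by (simp add: D(2) m_assoc)
  ultimately have "one_parameter_subgroup G A (Ad G A g X) (\<lambda>t. g \<otimes> \<gamma> t \<otimes> inv g)"
    unfolding one_parameter_subgroup_def by blast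
  from lie_exp_scale[OF this] lie_exp_scale[OF \<gamma>] show ?thesis by simp
qed

text \<open>
  Smoothness holds because \<open>Ad\<^sub>g X\<close> is the partial derivative of \<open>(g, h) \<mapsto> g h g\<^sup>-\<^sup>1\<close> in the second
  variable, at the unit and in direction \<open>X\<close>.
\<close>

lemma smooth_map_Ad: "smooth_map A vec_atlas (\<lambda>g. Ad G A g X)"
proof (rule smooth_mapI[OF atlas atlas_vec_atlas])
  fix c d g assume c: "c \<in> A" "g \<in> fst c" and d: "d \<in> (vec_atlas :: ('e, 'e) chart set)"
  have chc: "is_chart c" using c charts by blast
  have sm: "smooth_map (prod_atlas A A) A (\<lambda>(g, h). g \<otimes> h \<otimes> inv g)"
    unfolding case_prod_beta
    by (intro smooth_map_mult smooth_map_inv smooth_map_fst smooth_map_snd atlas atlas_prod_atlas)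
      unfold_locales
  have in1: "g \<otimes> \<one> \<otimes> inv g \<in> fst unit_chart" for g using unit_chart(2) by simp
  note partial = smooth_partial_derivative[OF atlas atlas atlas sm c(1) unit_chart(1,2,1)
      is_chartD(1)[OF chc] subset_refl in1]
  have Ad: "frechet_derivative (local_rep unit_chart unit_chart (\<lambda>h. g \<otimes> h \<otimes> inv g))
      (at (snd unit_chart \<one>)) = Ad G A g" if "g \<in> fst c" for g
    by (rule chart_deriv_unique[OF partial(2)[OF that] chart_deriv_Ad])
  have rep: "smooth_on (snd c ` fst c) (\<lambda>y. Ad G A (chart_inv c y) X)"
    by (rule smooth_on_cong[OF is_chartD(2)[OF chc] _ partial(1)[where v = X]])
      (simp add: Ad chart_inv_in)
  show "smooth_at c d (\<lambda>g. Ad G A g X) g"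
  proof (rule smooth_atI[OF chc _ is_chartD(1)[OF chc] c(2) subset_refl])
    show "is_chart d" using d by (simp add: vec_atlas_def is_chart_vec)
    show "(\<lambda>g. Ad G A g X) ` fst c \<subseteq> fst d" using d by (simp add: vec_atlas_def)
    show "smooth_on (snd c ` fst c) (local_rep c d (\<lambda>g. Ad G A g X))"
      using rep d by (simp add: vec_atlas_def local_rep_def o_def)
    have "continuous_on (fst c) (\<lambda>g. Ad G A (chart_inv c (snd c g)) X)"
      by (rule continuous_on_compose2[OF smooth_on_imp_continuous_on[OF rep]
            chart_continuous_on[OF chc] subset_refl])
    then show "continuous_on (fst c) (\<lambda>g. Ad G A g X)"
      by (rule continuous_on_eq) (simp add: chart_inv_chart[OF chc])
  qed
qed

text \<open>
  In an orthonormal basis of the Lie algebra \<open>Ad\<^sup>*\<^sub>g \<xi> = (\<Sum>b. \<xi> (Ad\<^sub>g b) \<langle>\<cdot>, b\<rangle>)\<close>, so smoothness of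
  the coadjoint representation follows from that of the maps \<open>g \<mapsto> Ad\<^sub>g b\<close>.
\<close>

lemma smooth_map_Ad_star:
  assumes P: "atlas P" and g: "smooth_map P A g" and \<xi>: "smooth_map P vec_atlas \<xi>"
  shows "smooth_map P vec_atlas (\<lambda>x. Ad_star G A (g x) (\<xi> x))"
proof -
  obtain B :: "'e set" where B: "\<And>x. x = (\<Sum>b\<in>B. inner x b *\<^sub>R b)"
    using finite_dim_inner_expansion by metis
  have "Ad_star G A g \<xi> = (\<Sum>b\<in>B. blinfun_apply \<xi> (Ad G A g b) *\<^sub>R blinfun_inner_left b)" for g \<xi>
  proof (rule blinfun_eqI)
    fix X
    have "Ad G A g X = (\<Sum>b\<in>B. inner X b *\<^sub>R Ad G A g b)"
      using arg_cong[OF B[of X], of "Ad G A g"] bounded_linear.linear[OF bounded_linear_Ad]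
      by (simp add: linear_sum linear_scale)
    then show "blinfun_apply (Ad_star G A g \<xi>) X =
        blinfun_apply (\<Sum>b\<in>B. blinfun_apply \<xi> (Ad G A g b) *\<^sub>R blinfun_inner_left b) X"
      by (simp add: Ad_star_apply blinfun.sum_right blinfun.sum_left blinfun.scaleR_right
          blinfun.scaleR_left mult.commute)
  qed
  moreover have "smooth_map P vec_atlas (\<lambda>x. \<Sum>b\<in>B. blinfun_apply (\<xi> x) (Ad G A (g x) b) *\<^sub>R
      blinfun_inner_left b)"
    by (intro smooth_map_sum smooth_map_bilinear[OF bounded_bilinear_scaleR]
        smooth_map_bilinear[OF bounded_bilinear_blinfun_apply] smooth_map_const atlas_vec_atlas P \<xi>
        smooth_map_compose[OF P atlas atlas_vec_atlas g smooth_map_Ad])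
  ultimately show ?thesis by simp
qed

end

section \<open>Lie group actions and fundamental vector fields\<close>

context lie_group
begin

text \<open>
  The element whose adjoint action describes how \<open>\<Phi>\<^sub>g\<close> transforms fundamental vector fields; it
  lets actions on either side be treated together.
\<close>

definition conjugator :: "side \<Rightarrow> 'g \<Rightarrow> 'g" where
  "conjugator \<sigma> g = (case \<sigma> of Left \<Rightarrow> inv g | Right \<Rightarrow> g)"

lemma smooth_map_conjugator:
  "atlas P \<Longrightarrow> smooth_map P A f \<Longrightarrow> smooth_map P A (\<lambda>x. conjugator \<sigma> (f x))"
  by (cases \<sigma>) (simp_all add: conjugator_def smooth_map_inv)

lemma Ad_star_mult: "Ad_star G A (g \<otimes> h) \<xi> = Ad_star G A h (Ad_star G A g \<xi>)"
  by (rule blinfun_eqI) (simp add: Ad_star_apply Ad_mult)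

lemma Ad_star_one: "Ad_star G A \<one> \<xi> = \<xi>"
  by (rule blinfun_eqI) (simp add: Ad_star_apply Ad_one)

lemma Ad_star_add: "Ad_star G A g (\<xi> + \<eta>) = Ad_star G A g \<xi> + Ad_star G A g \<eta>"
  by (rule blinfun_eqI) (simp add: Ad_star_apply blinfun.add_left)

lemma Ad_star_diff: "Ad_star G A g (\<xi> - \<eta>) = Ad_star G A g \<xi> - Ad_star G A g \<eta>"
  by (rule blinfun_eqI) (simp add: Ad_star_apply blinfun.diff_left)

lemma action_smooth:
  fixes B :: "('m::{t2_space, second_countable_topology}, 'f::finite_dim_inner) chart set"
  assumes act: "lie_action \<sigma> G A B \<Phi>" and at: "atlas P" "atlas B"
    and f: "smooth_map P A f" and x: "smooth_map P B x"
  shows "smooth_map P B (\<lambda>p. \<Phi> (f p) (x p))"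
proof (cases \<sigma>)
  case Left
  then have "smooth_map (prod_atlas A B) B (\<lambda>(g, x). \<Phi> g x)" using act by (simp add: lie_action_def)
  from smooth_map_compose[OF at(1) atlas_prod_atlas[OF atlas at(2)] at(2)
      smooth_map_Pair[OF at(1) atlas at(2) f x] this]
  show ?thesis by simp
next
  case Right
  then have "smooth_map (prod_atlas B A) B (\<lambda>(x, g). \<Phi> g x)" using act by (simp add: lie_action_def)
  from smooth_map_compose[OF at(1) atlas_prod_atlas[OF at(2) atlas] at(2)
      smooth_map_Pair[OF at(1) at(2) atlas x f] this]
  show ?thesis by simp
qed

text \<open>
  For an action on the left the group element on both sides is \<open>exp (s X) g\<close>, for an action on the
  right it is \<open>g exp (s X)\<close>.
\<close>

lemma action_intertwines:
  assumes "lie_action \<sigma> G A B \<Phi>"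
  shows "\<Phi> g (\<Phi> (lie_exp G A (s *\<^sub>R Ad G A (conjugator \<sigma> g) X)) x) =
    \<Phi> (lie_exp G A (s *\<^sub>R X)) (\<Phi> g x)"
proof (cases \<sigma>)
  case Left
  then have "\<Phi> g (\<Phi> h x) = \<Phi> (g \<otimes> h) x" for g h x using assms by (simp add: lie_action_def)
  then show ?thesis by (simp add: Left lie_exp_Ad conjugator_def m_assoc)
next
  case Right
  then have "\<Phi> g (\<Phi> h x) = \<Phi> (h \<otimes> g) x" for g h x using assms by (simp add: lie_action_def)
  then show ?thesis by (simp add: Right lie_exp_Ad conjugator_def m_assoc)
qed

lemma chart_deriv_fundamental_field:
  fixes B :: "('m::{t2_space, second_countable_topology}, 'f::finite_dim_inner) chart set"
  assumes act: "lie_action \<sigma> G A B \<Phi>" and at: "atlas B"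
  shows "chart_deriv vec_chart (chart_at B x) (\<lambda>s. \<Phi> (lie_exp G A (s *\<^sub>R X)) x) 0
    (\<lambda>h. h *\<^sub>R fundamental_field G A B \<Phi> X x)"
proof -
  obtain \<gamma> where \<gamma>: "one_parameter_subgroup G A X \<gamma>" using one_parameter_subgroup_exists by blast
  note D = one_parameter_subgroupD[OF \<gamma>]
  have "smooth_map vec_atlas B (\<lambda>s. \<Phi> (\<gamma> s) x)"
    by (intro action_smooth[OF act atlas_vec_atlas at D(1)] smooth_map_const atlas_vec_atlas at)
  from chart_deriv_velocity[OF at this, of 0] show ?thesis
    using act by (simp add: fundamental_field_def lie_exp_scale[OF \<gamma>] D(3) lie_action_def)
qed

lemma smooth_map_action:
  fixes B :: "('m::{t2_space, second_countable_topology}, 'f::finite_dim_inner) chart set"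
  assumes "smooth_manifold B" "lie_action \<sigma> G A B \<Phi>"
  shows "smooth_map B B (\<Phi> g)"
  using action_smooth[OF assms(2) smooth_manifold.atlas[OF assms(1)] smooth_manifold.atlas[OF assms(1)]
      smooth_map_const[OF smooth_manifold.atlas[OF assms(1)] atlas]
      smooth_manifold.smooth_map_id[OF assms(1)]] .

text \<open>
  This is the derivative of \<open>action_intertwines\<close> at \<open>s = 0\<close>.
\<close>

lemma tangent_map_fundamental_field:
  fixes B :: "('m::{t2_space, second_countable_topology}, 'f::finite_dim_inner) chart set"
  assumes man: "smooth_manifold B" and act: "lie_action \<sigma> G A B \<Phi>"
  shows "tangent_map B B (\<Phi> g) x (fundamental_field G A B \<Phi> (Ad G A (conjugator \<sigma> g) X) x) =
    fundamental_field G A B \<Phi> X (\<Phi> g x)"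
proof -
  let ?Y = "Ad G A (conjugator \<sigma> g) X"
  have at: "atlas B" using man by (rule smooth_manifold.atlas)
  have T: "chart_deriv (chart_at B x) (chart_at B (\<Phi> g x)) (\<Phi> g) x (tangent_map B B (\<Phi> g) x)"
    by (rule chart_deriv_tangent_map[OF at at smooth_map_action[OF man act]])
  have "lie_exp G A (0 *\<^sub>R ?Y) = \<one>"
    using one_parameter_subgroup_exists[of ?Y] lie_exp_scale one_parameter_subgroupD(3) by metis
  then have x: "\<Phi> (lie_exp G A (0 *\<^sub>R ?Y)) x = x" using act by (simp add: lie_action_def)
  have "chart_deriv vec_chart (chart_at B (\<Phi> g x)) (\<lambda>s. \<Phi> (lie_exp G A (s *\<^sub>R X)) (\<Phi> g x)) 0
      (\<lambda>h. tangent_map B B (\<Phi> g) x (h *\<^sub>R fundamental_field G A B \<Phi> ?Y x))"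
    using chart_deriv_compose[OF chart_deriv_fundamental_field[OF act at, of x ?Y],
        of "chart_at B (\<Phi> g x)" "\<Phi> g" "tangent_map B B (\<Phi> g) x"] T
    unfolding x action_intertwines[OF act] by blast
  from fun_cong[OF chart_deriv_unique[OF this chart_deriv_fundamental_field[OF act at]], of 1]
  show ?thesis by simp
qed

section \<open>Equivariance of the momentum map\<close>

text \<open>
  Paired with \<open>X\<close>, both terms have the differential \<open>u \<mapsto> - \<omega> (Y\<^sub>M, u)\<close>, where \<open>Y = Ad\<^sub>c X\<close> with \<open>c\<close> the
  conjugator of \<open>g\<close>: for the first one because \<open>T\<Phi>\<^sub>g\<close> preserves \<open>\<omega>\<close> and maps \<open>Y\<^sub>M\<close> to \<open>X\<^sub>M\<close>.
\<close>

lemma momentum_map_defect_constant: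
  fixes B :: "('m::{t2_space, second_countable_topology}, 'f::finite_dim_inner) chart set"
  assumes symp: "symplectic_manifold B \<omega>" and conn: "connected (UNIV :: 'm set)"
    and ham: "hamiltonian_action \<sigma> G A B \<omega> \<Phi>" and mom: "momentum_map G A B \<omega> \<Phi> J"
  shows "J (\<Phi> g x) - Ad_star G A (conjugator \<sigma> g) (J x) =
    J (\<Phi> g y) - Ad_star G A (conjugator \<sigma> g) (J y)"
proof (rule blinfun_eqI)
  fix X
  let ?Y = "Ad G A (conjugator \<sigma> g) X"
  let ?F = "\<lambda>x. blinfun_apply (J (\<Phi> g x)) X - blinfun_apply (J x) ?Y"
  have man: "smooth_manifold B" using symp by (simp add: symplectic_manifold_def)
  have at: "atlas B" using man by (rule smooth_manifold.atlas)
  have act: "lie_action \<sigma> G A B \<Phi>" and pull: "\<And>g. pullback B B (\<Phi> g) \<omega> = \<omega>"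
    using ham by (simp_all add: hamiltonian_action_def)
  have J: "smooth_map B vec_atlas (\<lambda>x. blinfun_apply (J x) Z)"
    "tangent_map B vec_atlas (\<lambda>x. blinfun_apply (J x) Z) p u =
      - \<omega> p (fundamental_field G A B \<Phi> Z p) u" for Z p u
    using mom by (simp_all add: momentum_map_def is_hamiltonian_of_def)
  have dJ: "chart_deriv (chart_at B p) vec_chart (\<lambda>x. blinfun_apply (J x) Z) p
      (\<lambda>u. - \<omega> p (fundamental_field G A B \<Phi> Z p) u)" for Z p
    using chart_deriv_tangent_map[OF at atlas_vec_atlas J(1), of p Z]
    by (simp add: chart_at_vec_atlas J(2)[abs_def])
  have "?F x = ?F y"
  proof (rule zero_derivative_imp_constant[where f = ?F, OF man smooth_manifold_vec_atlas open_UNIV conn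
        _ UNIV_I UNIV_I])
    fix p
    let ?T = "tangent_map B B (\<Phi> g) p"
    have "\<omega> (\<Phi> g p) (fundamental_field G A B \<Phi> X (\<Phi> g p)) (?T u) =
        \<omega> p (fundamental_field G A B \<Phi> ?Y p) u" for u
    proof -
      have "\<omega> (\<Phi> g p) (?T v) (?T u) = \<omega> p v u" for v
        using fun_cong[OF fun_cong[OF fun_cong[OF pull[of g]]], of p v u] by (simp add: pullback_def)
      then show ?thesis using tangent_map_fundamental_field[OF man act] by metis
    qed
    then have "chart_deriv (chart_at B p) vec_chart (\<lambda>x. blinfun_apply (J (\<Phi> g x)) X) p
        (\<lambda>u. - \<omega> p (fundamental_field G A B \<Phi> ?Y p) u)"
      using chart_deriv_compose[OF chart_deriv_tangent_map[OF at at smooth_map_action[OF man act]]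
          dJ[of "\<Phi> g p" X]] by simp
    from chart_deriv_diff[OF this dJ[of p ?Y]]
    have "chart_deriv (chart_at B p) vec_chart ?F p (\<lambda>_. 0)" by simp
    then show "\<exists>c\<in>B. \<exists>d\<in>vec_atlas. chart_deriv c d ?F p (\<lambda>_. 0)"
      using chart_at_in[OF at, of p] unfolding vec_atlas_def by blast
  qed
  then show "blinfun_apply (J (\<Phi> g x) - Ad_star G A (conjugator \<sigma> g) (J x)) X =
      blinfun_apply (J (\<Phi> g y) - Ad_star G A (conjugator \<sigma> g) (J y)) X"
    by (simp add: Ad_star_apply blinfun.diff_left)
qed

text \<open>
  Equivariance at \<open>x\<^sub>0\<close> forces the value \<open>J (\<Phi>\<^sub>g x\<^sub>0)\<close> at \<open>J x\<^sub>0\<close>; centring the affine map at \<open>J x\<^sub>0\<close> makes its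
  composition law a comparison of values at that point.
\<close>

definition affine_coadjoint ::
  "side \<Rightarrow> ('g \<Rightarrow> 'm \<Rightarrow> 'm) \<Rightarrow> ('m \<Rightarrow> 'e \<Rightarrow>\<^sub>L real) \<Rightarrow> 'm \<Rightarrow> 'g \<Rightarrow> ('e \<Rightarrow>\<^sub>L real) \<Rightarrow> 'e \<Rightarrow>\<^sub>L real" where
  "affine_coadjoint \<sigma> \<Phi> J x\<^sub>0 g \<xi> = Ad_star G A (conjugator \<sigma> g) (\<xi> - J x\<^sub>0) + J (\<Phi> g x\<^sub>0)"

lemma affine_coadjoint_equivariant:
  fixes B :: "('m::{t2_space, second_countable_topology}, 'f::finite_dim_inner) chart set"
  assumes "symplectic_manifold B \<omega>" "connected (UNIV :: 'm set)"
    "hamiltonian_action \<sigma> G A B \<omega> \<Phi>" "momentum_map G A B \<omega> \<Phi> J"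
  shows "J (\<Phi> g x) = affine_coadjoint \<sigma> \<Phi> J x\<^sub>0 g (J x)"
  using momentum_map_defect_constant[OF assms, of g x x\<^sub>0]
  by (simp add: affine_coadjoint_def Ad_star_diff algebra_simps)

lemma smooth_map_affine_coadjoint:
  fixes B :: "('m::{t2_space, second_countable_topology}, 'f::finite_dim_inner) chart set"
  assumes P: "atlas P" and B: "atlas B" and act: "lie_action \<sigma> G A B \<Phi>"
    and J: "smooth_map B vec_atlas J"
    and f: "smooth_map P A f" and \<xi>: "smooth_map P vec_atlas \<xi>"
  shows "smooth_map P vec_atlas (\<lambda>p. affine_coadjoint \<sigma> \<Phi> J x\<^sub>0 (f p) (\<xi> p))"
proof -
  have "smooth_map P vec_atlas (\<lambda>p. \<xi> p + (- J x\<^sub>0))"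
    by (intro smooth_map_add P \<xi> smooth_map_const atlas_vec_atlas)
  moreover have "smooth_map P vec_atlas (\<lambda>p. J (\<Phi> (f p) x\<^sub>0))"
    by (rule smooth_map_compose[OF P B atlas_vec_atlas
          action_smooth[OF act P B f smooth_map_const[OF P B]] J])
  ultimately show ?thesis
    unfolding affine_coadjoint_def
    by (intro smooth_map_add smooth_map_Ad_star smooth_map_conjugator P f) simp_all
qed

lemma lie_action_affine_coadjoint:
  fixes B :: "('m::{t2_space, second_countable_topology}, 'f::finite_dim_inner) chart set"
  assumes symp: "symplectic_manifold B \<omega>" and conn: "connected (UNIV :: 'm set)"
    and ham: "hamiltonian_action \<sigma> G A B \<omega> \<Phi>" and mom: "momentum_map G A B \<omega> \<Phi> J"
  shows "lie_action \<sigma> G A vec_atlas (affine_coadjoint \<sigma> \<Phi> J x\<^sub>0)"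
proof -
  let ?A = "affine_coadjoint \<sigma> \<Phi> J x\<^sub>0"
  have at: "atlas B"
    using symp smooth_manifold.atlas by (auto simp: symplectic_manifold_def)
  have act: "lie_action \<sigma> G A B \<Phi>" using ham by (simp add: hamiltonian_action_def)
  have J: "smooth_map B vec_atlas J" using mom by (simp add: momentum_map_def)
  note equiv = affine_coadjoint_equivariant[OF symp conn ham mom, of _ _ x\<^sub>0]
    and sm = smooth_map_affine_coadjoint[OF _ at act J, of _ _ _ x\<^sub>0]
  have one: "?A \<one> \<xi> = \<xi>" for \<xi>
    using act by (cases \<sigma>) (simp_all add: affine_coadjoint_def conjugator_def Ad_star_one lie_action_def)
  \<comment> \<open>The translation parts match because \<open>J (\<Phi>\<^sub>g (\<Phi>\<^sub>h x\<^sub>0)) = A\<^sub>g (J (\<Phi>\<^sub>h x\<^sub>0))\<close>.\<close>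
  have comp: "?A g (?A h \<xi>) =
      Ad_star G A (conjugator \<sigma> g) (Ad_star G A (conjugator \<sigma> h) (\<xi> - J x\<^sub>0)) + J (\<Phi> g (\<Phi> h x\<^sub>0))"
    for g h \<xi>
    unfolding equiv[of g "\<Phi> h x\<^sub>0"] by (simp add: affine_coadjoint_def Ad_star_add Ad_star_diff)
  show ?thesis
  proof (cases \<sigma>)
    case Left
    have "smooth_map (prod_atlas A vec_atlas) vec_atlas (\<lambda>p. ?A (fst p) (snd p))"
      by (intro sm atlas_prod_atlas atlas atlas_vec_atlas smooth_map_fst smooth_manifold_axioms
          smooth_map_vec_atlas_snd)
    moreover have "\<Phi> (g \<otimes> h) x = \<Phi> g (\<Phi> h x)" for g h x
      using act Left by (simp add: lie_action_def)
    then have "?A (g \<otimes> h) \<xi> = ?A g (?A h \<xi>)" for g h \<xi>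
      unfolding comp
      by (simp add: affine_coadjoint_def conjugator_def Left inv_mult_group Ad_star_mult)
    ultimately show ?thesis using one Left by (simp add: lie_action_def case_prod_unfold)
  next
    case Right
    have "smooth_map (prod_atlas vec_atlas A) vec_atlas (\<lambda>p. ?A (snd p) (fst p))"
      by (intro sm atlas_prod_atlas atlas atlas_vec_atlas smooth_map_snd smooth_manifold_axioms
          smooth_map_vec_atlas_fst)
    moreover have "\<Phi> (g \<otimes> h) x = \<Phi> h (\<Phi> g x)" for g h x
      using act Right by (simp add: lie_action_def)
    then have "?A (g \<otimes> h) \<xi> = ?A h (?A g \<xi>)" for g h \<xi>
      unfolding comp by (simp add: affine_coadjoint_def conjugator_def Right Ad_star_mult)
    ultimately show ?thesis using one Right by (simp add: lie_action_def case_prod_unfold)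
  qed
qed

lemma affine_coadjoint_cocycle:
  "\<exists>\<theta>. \<forall>g \<xi>. affine_coadjoint \<sigma> \<Phi> J x\<^sub>0 g \<xi> =
    (case \<sigma> of Left \<Rightarrow> Ad_star G A (inv g) \<xi> + \<theta> g | Right \<Rightarrow> Ad_star G A g \<xi> - \<theta> (inv g))"
proof (cases \<sigma>)
  case Left
  then show ?thesis
    by (intro exI[of _ "\<lambda>g. J (\<Phi> g x\<^sub>0) - Ad_star G A (inv g) (J x\<^sub>0)"])
      (simp add: affine_coadjoint_def conjugator_def Ad_star_diff)
next
  case Right
  then show ?thesis
    by (intro exI[of _ "\<lambda>g. Ad_star G A (inv g) (J x\<^sub>0) - J (\<Phi> (inv g) x\<^sub>0)"])
      (simp add: affine_coadjoint_def conjugator_def Ad_star_diff)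
qed

text \<open>An affine map with given linear part is determined by its value at one point.\<close>

lemma affine_coadjoint_unique:
  assumes equiv: "\<And>g x. J (\<Phi> g x) = A' g (J x)"
    and aff: "\<And>g \<xi>. A' g \<xi> = (case \<sigma> of
        Left \<Rightarrow> Ad_star G A (inv g) \<xi> + \<theta> g | Right \<Rightarrow> Ad_star G A g \<xi> - \<theta> (inv g))"
  shows "A' = affine_coadjoint \<sigma> \<Phi> J x\<^sub>0"
proof (intro ext)
  fix g \<xi>
  have "A' g \<xi> = Ad_star G A (conjugator \<sigma> g) (\<xi> - J x\<^sub>0) + A' g (J x\<^sub>0)"
    unfolding aff by (cases \<sigma>) (simp_all add: conjugator_def Ad_star_diff)
  then show "A' g \<xi> = affine_coadjoint \<sigma> \<Phi> J x\<^sub>0 g \<xi>"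
    by (simp add: affine_coadjoint_def equiv)
qed

end

theorem proposition4p4p9:
  fixes G :: "'g::{t2_space, second_countable_topology} monoid"
    and A\<^sub>G :: "('g, 'e::finite_dim_inner) chart set"
    and A\<^sub>M :: "('m::{t2_space, second_countable_topology}, 'f::finite_dim_inner) chart set"
    and \<omega> :: "'m \<Rightarrow> 'f \<Rightarrow> 'f \<Rightarrow> real"
    and \<sigma> :: side
    and \<Phi> :: "'g \<Rightarrow> 'm \<Rightarrow> 'm"
    and J :: "'m \<Rightarrow> ('e \<Rightarrow>\<^sub>L real)"
  assumes "lie_group G A\<^sub>G"
    and "symplectic_manifold A\<^sub>M \<omega>"
    and "connected (UNIV :: 'm set)"
    and "hamiltonian_action \<sigma> G A\<^sub>G A\<^sub>M \<omega> \<Phi>"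
    and "momentum_map G A\<^sub>G A\<^sub>M \<omega> \<Phi> J"
  shows "\<exists>!A :: 'g \<Rightarrow> ('e \<Rightarrow>\<^sub>L real) \<Rightarrow> ('e \<Rightarrow>\<^sub>L real).
           lie_action \<sigma> G A\<^sub>G vec_atlas A \<and>
           (\<forall>g x. J (\<Phi> g x) = A g (J x)) \<and>
           (\<exists>\<theta> :: 'g \<Rightarrow> ('e \<Rightarrow>\<^sub>L real). \<forall>g \<xi>.
              A g \<xi> = (case \<sigma> of
                         Left \<Rightarrow> Ad_star G A\<^sub>G (inv\<^bsub>G\<^esub> g) \<xi> + \<theta> g
                       | Right \<Rightarrow> Ad_star G A\<^sub>G g \<xi> - \<theta> (inv\<^bsub>G\<^esub> g)))"
proof -
  interpret lie_group G A\<^sub>G by fact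
  fix x\<^sub>0 :: 'm
  let ?A = "affine_coadjoint \<sigma> \<Phi> J x\<^sub>0"
  show ?thesis
  proof (intro ex1I[of _ ?A] conjI allI)
    show "lie_action \<sigma> G A\<^sub>G vec_atlas ?A" by (rule lie_action_affine_coadjoint[OF assms(2-5)])
    show "J (\<Phi> g x) = ?A g (J x)" for g x by (rule affine_coadjoint_equivariant[OF assms(2-5)])
    show "\<exists>\<theta>. \<forall>g \<xi>. ?A g \<xi> = (case \<sigma> of
           Left \<Rightarrow> Ad_star G A\<^sub>G (inv\<^bsub>G\<^esub> g) \<xi> + \<theta> g
         | Right \<Rightarrow> Ad_star G A\<^sub>G g \<xi> - \<theta> (inv\<^bsub>G\<^esub> g))"
      by (rule affine_coadjoint_cocycle)
  next
    fix A' assume A': "lie_action \<sigma> G A\<^sub>G vec_atlas A' \<and> (\<forall>g x. J (\<Phi> g x) = A' g (J x)) \<and>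
        (\<exists>\<theta>. \<forall>g \<xi>. A' g \<xi> = (case \<sigma> of
           Left \<Rightarrow> Ad_star G A\<^sub>G (inv\<^bsub>G\<^esub> g) \<xi> + \<theta> g
         | Right \<Rightarrow> Ad_star G A\<^sub>G g \<xi> - \<theta> (inv\<^bsub>G\<^esub> g)))"
    then have equiv: "J (\<Phi> g x) = A' g (J x)" for g x by (elim conjE allE)
    from A' obtain \<theta> where aff: "A' g \<xi> = (case \<sigma> of
        Left \<Rightarrow> Ad_star G A\<^sub>G (inv\<^bsub>G\<^esub> g) \<xi> + \<theta> g
      | Right \<Rightarrow> Ad_star G A\<^sub>G g \<xi> - \<theta> (inv\<^bsub>G\<^esub> g))" for g \<xi>
      by (elim conjE exE) (rule that, erule allE, erule allE)
    show "A' = ?A" by (rule affine_coadjoint_unique[of J \<Phi> A' \<theta> \<sigma>, OF equiv aff])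
  qed
qed

end
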